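(* For every real $\alpha\in(0,\tfrac12)$ there exist constants $\nu_0=\nu_0(\alpha)>0$ and $\nu_1=\nu_1(\alpha)$ such that: (i) for every $0<\nu<\nu_0$, asymptotically almost surely (as $n\to\infty$) the random graph $G(n;\alpha,\nu)$ has no near perfect matching, and consequently no Hamilton cycle; (ii) for every $\nu>\nu_1$, asymptotically almost surely $G(n;\alpha,\nu)$ has a Hamilton cycle.
   Context: KPKVB model: fix $\alpha>0$, $\nu>0$ and an integer $n>\nu$, and let $R=2\ln(n/\nu)$, so that $n=\nu e^{R/2}$. Let $\mathcal D_R$ be the disk of hyperbolic radius $R$ centred at a fixed origin $O$ of the hyperbolic plane of curvature $-1$. Points are written in hyperbolic polar coordinates $(r,\theta)$, where $r\in[0,R)$ is the hyperbolic distance to $O$ and $\theta\in(0,2\pi]$ is the angle. The quasi-uniform density on $\mathcal D_R$ is $f_{\alpha,R}(r,\theta)=\frac{\alpha\sinh(\alpha r)}{2\pi(\cosh(\alpha R)-1)}$. The random graph $G(n;\alpha,\nu)$ has as vertex set $n$ i.i.d. points of $\mathcal D_R$ with density $f_{\alpha,R}$ (with respect to $dr\,d\theta$), two distinct vertices being adjacent iff their hyperbolic distance is at most $R$. A near perfect matching is a matching covering all but at most one vertex. An event holds asymptotically almost surely (a.a.s.) if its probability tends to $1$ as $n\to\infty$. *)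

theory Defs
  imports "HOL-Probability.Probability"
begin

text \<open>Points of the hyperbolic plane in hyperbolic polar coordinates (r, theta)
  with respect to the fixed origin O.\<close>

definition hyp_dist :: "real \<times> real \<Rightarrow> real \<times> real \<Rightarrow> real" where
  "hyp_dist p q = (case p of (r1, t1) \<Rightarrow> case q of (r2, t2) \<Rightarrow>
      arcosh (cosh r1 * cosh r2 - sinh r1 * sinh r2 * cos (t1 - t2)))"

definition kpkvb_R :: "real \<Rightarrow> nat \<Rightarrow> real" where
  "kpkvb_R \<nu> n = 2 * ln (real n / \<nu>)"

definition disk_R :: "real \<Rightarrow> (real \<times> real) set" where
  "disk_R R = {0..<R} \<times> {0<..2*pi}"

definition quasi_unif_density :: "real \<Rightarrow> real \<Rightarrow> real \<times> real \<Rightarrow> real" where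
  "quasi_unif_density \<alpha> R p =
     \<alpha> * sinh (\<alpha> * fst p) / (2 * pi * (cosh (\<alpha> * R) - 1))"

definition point_measure :: "real \<Rightarrow> real \<Rightarrow> (real \<times> real) measure" where
  "point_measure \<alpha> R = density lborel
     (\<lambda>p. ennreal (indicator (disk_R R) p * quasi_unif_density \<alpha> R p))"

definition kpkvb_space :: "nat \<Rightarrow> real \<Rightarrow> real \<Rightarrow> (nat \<Rightarrow> real \<times> real) measure" where
  "kpkvb_space n \<alpha> \<nu> = PiM {0..<n} (\<lambda>_. point_measure \<alpha> (kpkvb_R \<nu> n))"

definition kpkvb_adj :: "real \<Rightarrow> (nat \<Rightarrow> real \<times> real) \<Rightarrow> nat \<Rightarrow> nat \<Rightarrow> bool" where
  "kpkvb_adj R x i j \<longleftrightarrow> i \<noteq> j \<and> hyp_dist (x i) (x j) \<le> R"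

definition is_matching :: "nat \<Rightarrow> (nat \<Rightarrow> nat \<Rightarrow> bool) \<Rightarrow> nat set set \<Rightarrow> bool" where
  "is_matching n E M \<longleftrightarrow>
     (\<forall>e\<in>M. \<exists>i j. e = {i, j} \<and> i < n \<and> j < n \<and> E i j) \<and>
     (\<forall>e\<in>M. \<forall>e'\<in>M. e \<noteq> e' \<longrightarrow> e \<inter> e' = {})"

definition has_near_perfect_matching :: "nat \<Rightarrow> (nat \<Rightarrow> nat \<Rightarrow> bool) \<Rightarrow> bool" where
  "has_near_perfect_matching n E \<longleftrightarrow>
     (\<exists>M. is_matching n E M \<and> card ({0..<n} - \<Union>M) \<le> 1)"

definition has_hamilton_cycle :: "nat \<Rightarrow> (nat \<Rightarrow> nat \<Rightarrow> bool) \<Rightarrow> bool" where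
  "has_hamilton_cycle n E \<longleftrightarrow> 3 \<le> n \<and>
     (\<exists>\<sigma>. bij_betw \<sigma> {0..<n} {0..<n} \<and> (\<forall>k<n. E (\<sigma> k) (\<sigma> ((k + 1) mod n))))"

definition kpkvb_prob :: "real \<Rightarrow> real \<Rightarrow> (nat \<Rightarrow> (nat \<Rightarrow> nat \<Rightarrow> bool) \<Rightarrow> bool) \<Rightarrow> nat \<Rightarrow> real" where
  "kpkvb_prob \<alpha> \<nu> Q n = measure (kpkvb_space n \<alpha> \<nu>)
     {x \<in> space (kpkvb_space n \<alpha> \<nu>). Q n (kpkvb_adj (kpkvb_R \<nu> n) x)}"

definition kpkvb_aas :: "real \<Rightarrow> real \<Rightarrow> (nat \<Rightarrow> (nat \<Rightarrow> nat \<Rightarrow> bool) \<Rightarrow> bool) \<Rightarrow> bool" where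
  "kpkvb_aas \<alpha> \<nu> Q \<longleftrightarrow> (kpkvb_prob \<alpha> \<nu> Q \<longlonglongrightarrow> 1)"

end

theory Submission
  imports Defs "HOL-Real_Asymp.Real_Asymp"
begin

text \<open>
  For small \<open>\<nu>\<close>, call a point bad if it is deeper than a constant distance from the boundary, or if its
  angle is within a constant times \<open>exp (- R / 2)\<close> of that of an earlier point. Every edge has a bad
  endpoint, so a matching covers at most twice as many vertices as there are bad points. Conditionally
  on the earlier points, each point is bad with probability at most \<open>1 / 8\<close>, and an exponential moment
  shows that there are fewer than \<open>n / 3\<close> bad points.

  For large \<open>\<nu>\<close>, cut the disk into cells: the angular width of a cell of level \<open>l\<close> is \<open>2 ^ l\<close> times a
  constant multiple of \<open>exp (- R / 2)\<close>, and its distance from the boundary is about \<open>2 * l * ln 2\<close>.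
  A point of a cell is adjacent to every point of the sector below that cell, so if two halves of a sector
  are covered by \<open>a\<close> and \<open>b\<close> paths and the cell on top has \<open>m\<close> points, the whole sector is covered by
  \<open>max 1 (a + b - m)\<close> paths. Consequently \<open>exp\<close> of the number of paths is bounded by weights satisfying
  \<open>W = exp 1 + W' * W'' * exp (- m)\<close>, whose expectations stay at most \<open>2 * exp 1\<close> because every
  cell has a large expected number of points. As \<open>\<alpha> < 1 / 2\<close>, this expected number grows
  geometrically with \<open>l\<close>. At the level where cells enter the disk of radius \<open>R / 2\<close>, whose points form a
  clique, it is a power of \<open>n\<close>, and by Markov's inequality every sector is then spanned by a single path
  with both ends in this clique; these paths are concatenated to a Hamilton cycle.
\<close>

subsection \<open>Hyperbolic distance in polar coordinates\<close>

text \<open>The argument of \<open>arcosh\<close> is at least \<open>cosh (r1 - r2)\<close>, hence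
  at least 1, and \<open>arcosh\<close> is strictly increasing there. Adjacency thus becomes an
  inequality between hyperbolic cosines.\<close>

lemma hyp_dist_le_iff:
  assumes "0 \<le> r1" "0 \<le> r2" "0 \<le> R"
  shows "hyp_dist (r1, t1) (r2, t2) \<le> R \<longleftrightarrow>
    cosh r1 * cosh r2 - sinh r1 * sinh r2 * cos (t1 - t2) \<le> cosh R"
proof -
  let ?z = "cosh r1 * cosh r2 - sinh r1 * sinh r2 * cos (t1 - t2)"
  have s: "sinh r1 * sinh r2 * cos (t1 - t2) \<le> sinh r1 * sinh r2 * 1"
    using assms by (intro mult_left_mono) auto
  have "1 \<le> cosh (r1 - r2)" by (rule cosh_real_ge_1)
  also have "\<dots> \<le> ?z" using s by (simp add: cosh_diff)
  finally have z: "1 \<le> ?z" .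
  have "hyp_dist (r1, t1) (r2, t2) \<le> R \<longleftrightarrow> arcosh ?z \<le> arcosh (cosh R)"
    using assms by (simp add: hyp_dist_def arcosh_cosh_real)
  also have "\<dots> \<longleftrightarrow> ?z \<le> cosh R"
    using z cosh_real_ge_1[of R] by (metis arcosh_less_iff_real not_less)
  finally show ?thesis .
qed

text \<open>For \<open>f x = a * cosh x - b * sinh x\<close>, the identity
  \<open>sinh y * f x = sinh (y - x) * f 0 + sinh x * f y\<close> interpolates between the ends. The
  weights add up to at most \<open>sinh y\<close>, and \<open>0 \<le> a\<close> makes the maximum
  nonnegative.\<close>

lemma cosh_sinh_le_max_ends:
  fixes a b :: real
  assumes "0 \<le> x" "x \<le> y" "0 \<le> a"
  shows "a * cosh x - b * sinh x \<le> max a (a * cosh y - b * sinh y)"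
proof (cases "y = 0")
  case True
  then show ?thesis using assms by simp
next
  case False
  then have y: "0 < sinh y" using assms by simp
  let ?f = "\<lambda>x. a * cosh x - b * sinh x" and ?m = "max a (a * cosh y - b * sinh y)"
  have "sinh y * ?f x = sinh (y - x) * a + sinh x * ?f y"
    by (simp add: sinh_diff algebra_simps)
  also have "\<dots> \<le> sinh (y - x) * ?m + sinh x * ?m"
    using assms by (intro add_mono mult_left_mono) auto
  also have "\<dots> = (sinh (y - x) + sinh x) * ?m" by (simp add: algebra_simps)
  also have "\<dots> \<le> sinh y * ?m"
  proof (rule mult_right_mono)
    have "sinh (y - x) * 1 + 1 * sinh x \<le> sinh (y - x) * cosh x + cosh (y - x) * sinh x"
      using assms cosh_real_ge_1[of x] cosh_real_ge_1[of "y - x"]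
      by (intro add_mono mult_mono) auto
    also have "\<dots> = sinh ((y - x) + x)" by (rule sinh_add[symmetric])
    finally show "sinh (y - x) + sinh x \<le> sinh y" by simp
  qed (use assms in auto)
  finally show ?thesis using y by (simp add: mult_le_cancel_left)
qed

text \<open>For a fixed angle, the hyperbolic cosine of the distance is a convex function of each radius,
  so it suffices to check the corners of the rectangle of admissible radii.\<close>
lemma hyp_dist_le_if_angle_small:
  assumes r: "0 \<le> r1" "r1 \<le> R - y" "0 \<le> r2" "r2 \<le> R" and y: "0 \<le> y" "y \<le> R"
    and \<phi>: "(t1 - t2)\<^sup>2 \<le> exp (y - R) / 2"
  shows "hyp_dist (r1, t1) (r2, t2) \<le> R"
proof -
  define c where "c = cos (t1 - t2)"
  \<comment> \<open>The only corner that uses the angle. The claim is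
    \<open>sinh (R - y) * sinh R * (1 - c) \<le> cosh R - cosh y\<close>; half arguments give both
    sides the common factor \<open>2 * sinh ?u\<close>.\<close>
  have corner: "cosh (R - y) * cosh R - sinh (R - y) * c * sinh R \<le> cosh R"
  proof -
    let ?u = "(R - y) / 2" and ?v = "(R + y) / 2"
    have "1 - c \<le> (t1 - t2)\<^sup>2 / 2"
    proof -
      have "c = 1 - 2 * (sin ((t1 - t2) / 2))\<^sup>2"
        using cos_double_sin[of "(t1 - t2) / 2"] unfolding c_def by (simp only: mult_2 field_sum_of_halves)
      moreover have "(sin ((t1 - t2) / 2))\<^sup>2 \<le> ((t1 - t2) / 2)\<^sup>2"
        using abs_sin_x_le_abs_x by (simp only: abs_le_square_iff)
      ultimately show ?thesis by (simp add: power2_eq_square)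
    qed
    then have c: "1 - c \<le> exp (y - R) / 4" using \<phi> by simp
    have "sinh R = 2 * sinh (R/2) * cosh (R/2)" using sinh_double[of "R/2"] by simp
    have "cosh (R/2) * cosh ?u * (1 - c) \<le> exp (R/2) * exp ?u * (exp (y - R) / 4)"
    proof -
      have "cosh (R/2) \<le> exp (R/2)" "cosh ?u \<le> exp ?u"
        using y by (auto simp: cosh_def field_simps)
      moreover have "0 \<le> 1 - c" by (simp add: c_def)
      ultimately show ?thesis using c by (intro mult_mono) auto
    qed
    also have "\<dots> = exp (y / 2) / 4"
      by (simp add: exp_add[symmetric] field_simps)
    also have "\<dots> \<le> cosh (y/2) / 2" by (simp add: cosh_def field_simps)
    finally have *: "2 * cosh (R/2) * cosh ?u * (1 - c) \<le> cosh (y/2)" by simp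
    have "sinh (R/2) * (2 * cosh (R/2) * cosh ?u * (1 - c)) \<le> sinh (R/2) * cosh (y/2)"
      using * y by (intro mult_left_mono) auto
    also have "\<dots> \<le> sinh (R/2 + y/2)" using y by (simp add: sinh_add)
    also have "R/2 + y/2 = ?v" by (simp add: field_simps)
    finally have "sinh R * cosh ?u * (1 - c) \<le> sinh ?v"
      using \<open>sinh R = _\<close> by (simp add: algebra_simps)
    then have "2 * sinh ?u * (sinh R * cosh ?u * (1 - c)) \<le> 2 * sinh ?u * sinh ?v"
      using y by (intro mult_left_mono) auto
    moreover have "sinh (R - y) = 2 * sinh ?u * cosh ?u" using sinh_double[of ?u] by (simp only: mult_2 field_sum_of_halves)
    moreover have "cosh R - cosh y = 2 * sinh ?u * sinh ?v"
    proof -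
      have "R = ?v + ?u" "y = ?v - ?u" by (auto simp: field_simps)
      then have "cosh R - cosh y = cosh (?v + ?u) - cosh (?v - ?u)" by metis
      then show ?thesis by (simp add: cosh_add cosh_diff)
    qed
    ultimately have "sinh (R - y) * sinh R * (1 - c) \<le> cosh R - cosh y" by (simp add: algebra_simps)
    moreover have "cosh (R - y) * cosh R - sinh (R - y) * sinh R = cosh y"
      using cosh_diff[of "R - y" R] by simp
    ultimately show ?thesis by (simp add: algebra_simps)
  qed
  have mono: "cosh r2 \<le> cosh R" "cosh (R - y) \<le> cosh R"
    using r y by (auto simp: cosh_real_nonneg_le_iff)
  have "cosh r1 * cosh r2 - sinh r1 * sinh r2 * c
      = cosh r2 * cosh r1 - (sinh r2 * c) * sinh r1" by (simp add: algebra_simps)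
  also have "\<dots> \<le> max (cosh r2) (cosh r2 * cosh (R - y) - (sinh r2 * c) * sinh (R - y))"
    using r by (intro cosh_sinh_le_max_ends) auto
  also have "\<dots> = max (cosh r2) (cosh (R - y) * cosh r2 - (sinh (R - y) * c) * sinh r2)"
    by (simp add: algebra_simps)
  also have "\<dots> \<le> max (cosh r2) (max (cosh (R - y)) (cosh (R - y) * cosh R - (sinh (R - y) * c) * sinh R))"
    using r by (intro max.mono cosh_sinh_le_max_ends order.refl) auto
  also have "\<dots> \<le> cosh R" using corner mono by simp
  finally show ?thesis using r y by (subst hyp_dist_le_iff) (auto simp: c_def)
qed

text \<open>Opposite angles are the worst case and give \<open>cosh (r1 + r2)\<close>: this is the
  triangle inequality through the origin.\<close>

lemma hyp_dist_le_if_radii_small: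
  assumes "0 \<le> r1" "0 \<le> r2" "r1 + r2 \<le> R"
  shows "hyp_dist (r1, t1) (r2, t2) \<le> R"
proof -
  have "sinh r1 * sinh r2 * (-1) \<le> sinh r1 * sinh r2 * cos (t1 - t2)"
    using assms by (intro mult_left_mono) auto
  then have "cosh r1 * cosh r2 - sinh r1 * sinh r2 * cos (t1 - t2) \<le> cosh (r1 + r2)"
    by (simp add: cosh_add)
  also have "\<dots> \<le> cosh R" using assms by (simp add: cosh_real_nonneg_le_iff)
  finally show ?thesis using assms by (subst hyp_dist_le_iff) auto
qed

text \<open>The left-hand cosine expression is twice the square of \<open>sin (x / 2)\<close>, and
  \<open>x / 4 \<le> sin (x / 2)\<close> by the mean value theorem, as the cosine is at least 1/2 up
  to \<open>pi / 3\<close>.\<close>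

lemma one_minus_cos_ge:
  assumes "0 \<le> x" "x \<le> (1::real)"
  shows "x\<^sup>2 / 8 \<le> 1 - cos x"
proof -
  have "x / 4 \<le> sin (x / 2)"
  proof (cases "x = 0")
    case False
    then have "\<exists>z>0. z < x / 2 \<and> sin (x / 2) - sin 0 = (x / 2 - 0) * cos z"
      using assms by (intro MVT2) (auto intro!: derivative_eq_intros)
    then obtain z where z: "0 < z" "z < x / 2" "sin (x / 2) = x / 2 * cos z" by auto
    have "cos (pi / 3) \<le> cos z" using z assms pi_gt3 by (intro cos_monotone_0_pi_le) auto
    then have "x / 2 * (1 / 2) \<le> x / 2 * cos z" using assms by (intro mult_left_mono) (auto simp: cos_60)
    then show ?thesis unfolding z(3) by simp
  qed simp
  then have "(x / 4)\<^sup>2 \<le> (sin (x / 2))\<^sup>2" using assms by (intro power_mono) auto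
  then show ?thesis using cos_double_sin[of "x / 2"] by (simp add: power2_eq_square)
qed

text \<open>A partial converse of \<open>hyp_dist_le_if_angle_small\<close> for points within
  \<open>C\<close> of the boundary. There both hyperbolic sines are at least
  \<open>exp (R - C) / 4\<close>, which forces \<open>1 - c\<close> to be of order
  \<open>exp (- R)\<close>. Angles matter modulo \<open>2 * pi\<close>, hence the shifts
  \<open>k\<close>.\<close>

lemma angle_small_if_hyp_dist_le:
  assumes r: "R - C \<le> r1" "r1 \<le> R" "R - C \<le> r2" "r2 \<le> R" and C: "0 \<le> C" "C + 1 \<le> R"
    and adj: "hyp_dist (r1, t1) (r2, t2) \<le> R"
    and t: "\<bar>t1 - t2\<bar> \<le> 2 * pi"
    and small: "16 * exp C * exp (- R / 2) \<le> 1"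
  shows "\<exists>k\<in>{-2 * pi, 0, 2 * pi}. \<bar>t1 - t2 - k\<bar> \<le> 16 * exp C * exp (- R / 2)"
proof -
  define \<phi> where "\<phi> = 16 * exp C * exp (- R / 2)"
  define c where "c = cos (t1 - t2)"
  have \<phi>0: "0 < \<phi>" "\<phi> \<le> 1" using small by (auto simp: \<phi>_def)
  have sinh_ge: "exp (R - C) / 4 \<le> sinh s" if "R - C \<le> s" for s
  proof -
    have s1: "1 \<le> s" using that C by simp
    have "exp (-s) \<le> exp (-1)" using s1 by simp
    also have "\<dots> \<le> (1/2::real)" using exp_ge_add_one_self[of 1] by (simp add: exp_minus field_simps)
    also have "\<dots> \<le> exp s / 2" using s1 by simp
    finally have "exp s / 4 \<le> sinh s" by (simp add: sinh_def)
    moreover have "exp (R - C) \<le> exp s" using that by simp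
    ultimately show ?thesis by linarith
  qed
  have "cosh r1 * cosh r2 - sinh r1 * sinh r2 * c \<le> cosh R"
    using adj r C by (subst (asm) hyp_dist_le_iff) (auto simp: c_def)
  moreover have "0 < cosh (r1 - r2)" by simp
  ultimately have "sinh r1 * sinh r2 * (1 - c) < cosh R"
    by (simp add: cosh_diff algebra_simps)
  also have "\<dots> \<le> exp R" using C by (simp add: cosh_def)
  finally have "sinh r1 * sinh r2 * (1 - c) < exp R" .
  moreover have "(exp (R - C) / 4) * (exp (R - C) / 4) * (1 - c) \<le> sinh r1 * sinh r2 * (1 - c)"
    using sinh_ge[of r1] sinh_ge[of r2] r
    using C by (intro mult_right_mono mult_mono) (auto simp: c_def)
  ultimately have "exp (R - C) * exp (R - C) * (1 - c) < 16 * exp R" by simp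
  then have "1 - c < 16 * exp R / (exp (R - C) * exp (R - C))" by (simp add: field_simps)
  also have "\<dots> = \<phi>\<^sup>2 / 16"
    by (simp add: \<phi>_def power2_eq_square exp_diff exp_minus field_simps flip: exp_add)
  also have "\<dots> \<le> \<phi>\<^sup>2 / 8" by simp
  also have "\<dots> \<le> 1 - cos \<phi>" using \<phi>0 by (intro one_minus_cos_ge) auto
  finally have cc: "cos \<phi> < c" by simp
  \<comment> \<open>The cosine decreases on \<open>[0, pi]\<close>, so \<open>cos \<phi> < c\<close>
    bounds any representative of the angle difference in \<open>[- pi, pi]\<close>. One of the three
    shifts yields such a representative.\<close>
  have close: "\<bar>v\<bar> \<le> \<phi>" if "\<bar>v\<bar> \<le> pi" "cos v = c" for v
  proof (rule ccontr)
    assume "\<not> \<bar>v\<bar> \<le> \<phi>"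
    then have "cos \<bar>v\<bar> \<le> cos \<phi>" using that \<phi>0 by (intro cos_monotone_0_pi_le) auto
    then show False using cc that by simp
  qed
  consider "\<bar>t1 - t2\<bar> \<le> pi" | "\<bar>t1 - t2 - 2 * pi\<bar> \<le> pi" | "\<bar>t1 - t2 - (-2 * pi)\<bar> \<le> pi"
    using t by linarith
  then show ?thesis
  proof cases
    case 1
    then show ?thesis using close[of "t1 - t2"] by (auto simp: c_def \<phi>_def)
  next
    case 2
    have "cos (t1 - t2 - 2 * pi) = c" by (simp add: c_def cos_diff[of "t1 - t2" "2 * pi"])
    then show ?thesis using 2 close[of "t1 - t2 - 2 * pi"] by (auto simp: \<phi>_def)
  next
    case 3
    have "cos (t1 - t2 - (-2 * pi)) = c" by (simp add: c_def)
    then show ?thesis using 3 close[of "t1 - t2 - (-2 * pi)"] by (auto simp: \<phi>_def)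
  qed
qed

subsection \<open>The quasi-uniform measure\<close>

lemma sets_point_measure [simp, measurable_cong]: "sets (point_measure \<alpha> R) = sets borel"
  by (simp add: point_measure_def)

lemma space_point_measure [simp]: "space (point_measure \<alpha> R) = UNIV"
  by (simp add: point_measure_def)

lemma fst_borel_measurable_pair [measurable]: "(fst :: real \<times> real \<Rightarrow> real) \<in> borel_measurable borel"
  and snd_borel_measurable_pair [measurable]: "(snd :: real \<times> real \<Rightarrow> real) \<in> borel_measurable borel"
  by (simp_all add: borel_prod[symmetric])

text \<open>The density depends on the radius only, so the mass factors into the length of
  \<open>T\<close> and a radial integral with antiderivative
  \<open>cosh (\<alpha> * r) / D\<close>.\<close>

lemma emeasure_point_measure_Times:
  assumes "0 < \<alpha>" "0 < R" "0 \<le> a" "a \<le> b" "b \<le> R"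
    and [measurable]: "T \<in> sets borel" and T: "T \<subseteq> {0<..2 * pi}"
  shows "emeasure (point_measure \<alpha> R) ({a..<b} \<times> T) =
    ennreal ((cosh (\<alpha> * b) - cosh (\<alpha> * a)) / (cosh (\<alpha> * R) - 1) / (2 * pi)) * emeasure lborel T"
proof -
  define D where "D = 2 * pi * (cosh (\<alpha> * R) - 1)"
  have "1 < cosh (\<alpha> * R)"
    using assms cosh_real_nonneg_less_iff[of 0 "\<alpha> * R"] by simp
  then have D: "0 < D" by (simp add: D_def)
  define f where "f = (\<lambda>r. \<alpha> * sinh (\<alpha> * r) / D)"
  have f_meas [measurable]: "f \<in> borel_measurable borel"
    unfolding f_def by (intro borel_measurable_continuous_onI continuous_intros) (use D in auto)
  have meas_rect [measurable]: "{a..<b} \<times> T \<in> sets (borel :: (real \<times> real) measure)"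
    by (simp add: borel_prod[symmetric])
  have [measurable]: "disk_R R \<in> sets borel"
    unfolding disk_R_def by (subst borel_prod[symmetric]) simp
  have [measurable]: "quasi_unif_density \<alpha> R \<in> borel_measurable borel"
    unfolding quasi_unif_density_def
    by (intro borel_measurable_continuous_onI continuous_intros) (use D in \<open>auto simp: D_def\<close>)
  have "emeasure (point_measure \<alpha> R) ({a..<b} \<times> T) =
     (\<integral>\<^sup>+p. ennreal (indicator (disk_R R) p * quasi_unif_density \<alpha> R p) * indicator ({a..<b} \<times> T) p \<partial>lborel)"
    unfolding point_measure_def by (subst emeasure_density) auto
  also have "\<dots> = (\<integral>\<^sup>+p. ennreal (f (fst p)) * indicator {a..<b} (fst p) * indicator T (snd p) \<partial>(lborel \<Otimes>\<^sub>M lborel))"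
    unfolding lborel_prod using assms T
    by (intro nn_integral_cong)
       (auto simp: indicator_def disk_R_def quasi_unif_density_def f_def D_def split: prod.splits)
  also have "\<dots> = (\<integral>\<^sup>+r. \<integral>\<^sup>+t. ennreal (f r) * indicator {a..<b} r * indicator T t \<partial>lborel \<partial>lborel)"
    by (subst lborel.nn_integral_fst[symmetric]) auto
  also have "\<dots> = (\<integral>\<^sup>+r. ennreal (f r) * indicator {a..<b} r * emeasure lborel T \<partial>lborel)"
    by (intro nn_integral_cong) (subst nn_integral_cmult_indicator, auto)
  also have "\<dots> = (\<integral>\<^sup>+r. ennreal (f r) * indicator {a..<b} r \<partial>lborel) * emeasure lborel T"
    by (rule nn_integral_multc) auto
  \<comment> \<open>Adding the null set \<open>{b}\<close> gives the closed interval required by the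
    fundamental theorem of calculus.\<close>
  also have "(\<integral>\<^sup>+r. ennreal (f r) * indicator {a..<b} r \<partial>lborel) = (\<integral>\<^sup>+r. ennreal (f r) * indicator {a..b} r \<partial>lborel)"
    using AE_lborel_singleton[of b] by (intro nn_integral_cong_AE) (auto simp: indicator_def)
  also have "\<dots> = ennreal (cosh (\<alpha> * b) / D - cosh (\<alpha> * a) / D)"
    using assms D unfolding f_def
    by (intro nn_integral_FTC_Icc f_meas[unfolded f_def]) (auto intro!: derivative_eq_intros)
  also have "cosh (\<alpha> * b) / D - cosh (\<alpha> * a) / D = (cosh (\<alpha> * b) - cosh (\<alpha> * a)) / (cosh (\<alpha> * R) - 1) / (2 * pi)"
    by (simp add: D_def diff_divide_distrib mult.commute)
  finally show ?thesis .
qed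

lemma disk_R_borel [measurable]: "disk_R R \<in> sets borel"
  unfolding disk_R_def by (subst borel_prod[symmetric]) simp

lemma emeasure_point_measure_disk:
  assumes "0 < \<alpha>" "0 < R"
  shows "emeasure (point_measure \<alpha> R) (disk_R R) = 1"
proof -
  have "1 < cosh (\<alpha> * R)"
    using assms cosh_real_nonneg_less_iff[of 0 "\<alpha> * R"] by simp
  then show ?thesis
    unfolding disk_R_def using assms
    by (subst emeasure_point_measure_Times) (auto simp flip: ennreal_mult)
qed

lemma emeasure_point_measure_disk_Int:
  assumes [measurable]: "A \<in> sets borel"
  shows "emeasure (point_measure \<alpha> R) A = emeasure (point_measure \<alpha> R) (A \<inter> disk_R R)"
proof -
  have [measurable]: "(\<lambda>p. indicator (disk_R R) p * quasi_unif_density \<alpha> R p) \<in> borel_measurable borel"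
  \<comment> \<open>If the normalizing factor is zero, division by zero makes the density
    identically \<open>0\<close>, which is measurable too.\<close>
  proof (cases "2 * pi * (cosh (\<alpha> * R) - 1) = 0")
    case False
    then have [measurable]: "quasi_unif_density \<alpha> R \<in> borel_measurable borel"
      unfolding quasi_unif_density_def
      by (intro borel_measurable_continuous_onI continuous_intros) auto
    show ?thesis by measurable
  qed (auto simp: quasi_unif_density_def)
  show ?thesis
    unfolding point_measure_def
    by (simp add: emeasure_density) (auto intro!: nn_integral_cong simp: indicator_def)
qed

lemma prob_space_point_measure:
  assumes "0 < \<alpha>" "0 < R"
  shows "prob_space (point_measure \<alpha> R)"
proof
  show "emeasure (point_measure \<alpha> R) (space (point_measure \<alpha> R)) = 1"
    using emeasure_point_measure_disk_Int[of UNIV \<alpha> R] emeasure_point_measure_disk[OF assms] by simp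
qed

lemma AE_point_measure_disk:
  assumes "0 < \<alpha>" "0 < R"
  shows "AE p in point_measure \<alpha> R. p \<in> disk_R R"
proof -
  interpret prob_space "point_measure \<alpha> R" using assms by (rule prob_space_point_measure)
  show ?thesis
    using emeasure_point_measure_disk[OF assms]
    by (intro AE_prob_1) (simp add: measure_def)
qed

lemma measure_point_measure_Ioc:
  assumes "0 < \<alpha>" "0 < R" "0 \<le> a" "a \<le> b" "b \<le> R" "0 \<le> s" "s \<le> t" "t \<le> 2 * pi"
  shows "measure (point_measure \<alpha> R) ({a..<b} \<times> {s<..t}) =
    (cosh (\<alpha> * b) - cosh (\<alpha> * a)) / (cosh (\<alpha> * R) - 1) * ((t - s) / (2 * pi))"
proof -
  have "1 < cosh (\<alpha> * R)"
    using assms cosh_real_nonneg_less_iff[of 0 "\<alpha> * R"] by simp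
  moreover have "cosh (\<alpha> * a) \<le> cosh (\<alpha> * b)"
    using assms by (simp add: cosh_real_nonneg_le_iff)
  ultimately show ?thesis
    unfolding measure_def using assms
    by (subst emeasure_point_measure_Times) (auto simp: enn2real_mult)
qed

text \<open>Since \<open>cosh (2 * z) - 1 = 2 * (sinh z)\<^sup>2\<close>, the mass is a squared
  ratio of hyperbolic sines, bounded through \<open>sinh x * exp y \<le> sinh (x + y)\<close>. For
  \<open>C > R\<close> the set misses the disk.\<close>

lemma measure_point_measure_radius_less:
  assumes "0 < \<alpha>" "0 < R" "0 \<le> C"
  shows "measure (point_measure \<alpha> R) {p. fst p < R - C} \<le> exp (- \<alpha> * C)"
proof (cases "C \<le> R")
  case True
  have c1: "1 < cosh (\<alpha> * R)"
    using assms cosh_real_nonneg_less_iff[of 0 "\<alpha> * R"] by simp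
  have meas: "{p :: real \<times> real. fst p < R - C} \<in> sets borel" by measurable
  have "{p. fst p < R - C} \<inter> disk_R R = {0..<R - C} \<times> {0<..2 * pi}"
    using assms by (auto simp: disk_R_def)
  then have "measure (point_measure \<alpha> R) {p. fst p < R - C}
      = measure (point_measure \<alpha> R) ({0..<R - C} \<times> {0<..2 * pi})"
    unfolding measure_def by (subst emeasure_point_measure_disk_Int[OF meas]) simp
  also have "\<dots> = (cosh (\<alpha> * (R - C)) - 1) / (cosh (\<alpha> * R) - 1)"
    using assms True by (subst measure_point_measure_Ioc) auto
  also have "\<dots> \<le> exp (- \<alpha> * C)"
  proof -
    define x where "x = \<alpha> * (R - C) / 2"
    define y where "y = \<alpha> * C / 2"
    have xy: "0 \<le> x" "0 \<le> y" using assms True by (auto simp: x_def y_def)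
    have "sinh x * exp y \<le> sinh (x + y)"
    proof -
      have "exp (- x - y) \<le> exp (y - x)" using xy by simp
      then show ?thesis by (simp add: sinh_def exp_add[symmetric] algebra_simps)
    qed
    then have "(sinh x * exp y)\<^sup>2 \<le> (sinh (x + y))\<^sup>2" using xy by (intro power_mono) auto
    moreover have cd: "cosh (2 * z) - 1 = 2 * (sinh z)\<^sup>2" for z :: real
      by (simp add: cosh_double cosh_square_eq)
    ultimately have "(cosh (2 * x) - 1) * (exp y)\<^sup>2 \<le> cosh (2 * (x + y)) - 1"
      by (simp only: cd) (simp add: power_mult_distrib)
    moreover have "2 * (x + y) = \<alpha> * R" "2 * x = \<alpha> * (R - C)" "(exp y)\<^sup>2 = exp (\<alpha> * C)"
      by (auto simp: x_def y_def field_simps exp_add[symmetric] power2_eq_square)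
    ultimately have "(cosh (\<alpha> * (R - C)) - 1) * exp (\<alpha> * C) \<le> cosh (\<alpha> * R) - 1" by simp
    then show ?thesis using c1 by (simp add: exp_minus field_simps)
  qed
  finally show ?thesis .
next
  case False
  have meas: "{p :: real \<times> real. fst p < R - C} \<in> sets borel" by measurable
  have "{p. fst p < R - C} \<inter> disk_R R = {}" using False by (auto simp: disk_R_def)
  then have "emeasure (point_measure \<alpha> R) {p. fst p < R - C} = 0"
    by (subst emeasure_point_measure_disk_Int[OF meas]) simp
  then show ?thesis by (simp add: measure_def)
qed

text \<open>The angle is uniform on \<open>{0<..2 * pi}\<close>; the bound is an inequality because
  \<open>{s..t}\<close> may stick out of this range.\<close>

lemma measure_point_measure_angle_le:
  assumes "0 < \<alpha>" "0 < R" "s \<le> t"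
  shows "measure (point_measure \<alpha> R) {p. snd p \<in> {s..t}} \<le> (t - s) / (2 * pi)"
proof -
  have [measurable]: "{p :: real \<times> real. snd p \<in> {s..t}} \<in> sets borel" by measurable
  have c1: "1 < cosh (\<alpha> * R)"
    using assms cosh_real_nonneg_less_iff[of 0 "\<alpha> * R"] by simp
  have "emeasure (point_measure \<alpha> R) {p. snd p \<in> {s..t}} =
      emeasure (point_measure \<alpha> R) ({0..<R} \<times> ({0<..2 * pi} \<inter> {s..t}))"
    by (subst emeasure_point_measure_disk_Int, measurable)
       (auto intro!: arg_cong[of _ _ "emeasure (point_measure \<alpha> R)"] simp: disk_R_def)
  also have "\<dots> = ennreal (1 / (2 * pi)) * emeasure lborel ({0<..2 * pi} \<inter> {s..t})"
    using assms c1 by (subst emeasure_point_measure_Times) auto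
  also have "\<dots> \<le> ennreal (1 / (2 * pi)) * emeasure lborel {s..t}"
    by (intro mult_left_mono emeasure_mono) auto
  also have "\<dots> = ennreal ((t - s) / (2 * pi))" using assms by (simp flip: ennreal_mult)
  finally show ?thesis
    unfolding measure_def using assms by (intro enn2real_leI) auto
qed

subsection \<open>Path covers, Hamilton cycles and matchings\<close>

text \<open>Paths are nonempty so that \<open>hd\<close> and \<open>last\<close> are vertices.
  Distinctness of the concatenation makes the paths simple and mutually disjoint.\<close>

definition path_cover :: "('a \<Rightarrow> 'a \<Rightarrow> bool) \<Rightarrow> 'a list list \<Rightarrow> 'a set \<Rightarrow> bool" where
  "path_cover E ps S \<longleftrightarrow> (\<forall>p\<in>set ps. p \<noteq> [] \<and> successively E p) \<and>
     distinct (concat ps) \<and> set (concat ps) = S"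

lemma path_cover_append:
  assumes "path_cover E ps S" "path_cover E qs T" "S \<inter> T = {}"
  shows "path_cover E (ps @ qs) (S \<union> T)"
  using assms by (auto simp: path_cover_def)

text \<open>Any enumeration of a clique is a path. The empty set gets the empty cover, since empty
  paths are excluded.\<close>

lemma path_cover_clique:
  assumes "finite S" "\<And>u v. u \<in> S \<Longrightarrow> v \<in> S \<Longrightarrow> u \<noteq> v \<Longrightarrow> E u v"
  shows "\<exists>ps. path_cover E ps S \<and> length ps \<le> 1"
proof -
  obtain xs where xs: "set xs = S" "distinct xs" using finite_distinct_list[OF assms(1)] by blast
  have "sorted_wrt E xs" using xs assms(2)
    by (auto simp: sorted_wrt_iff_nth_less distinct_conv_nth)
  then have *: "successively E xs" by (rule successively_if_sorted_wrt)
  show ?thesis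
  proof (cases "xs = []")
    case True
    then show ?thesis using xs by (intro exI[of _ "[]"]) (auto simp: path_cover_def)
  next
    case False
    then show ?thesis using xs * by (intro exI[of _ "[xs]"]) (auto simp: path_cover_def)
  qed
qed

text \<open>A vertex adjacent to everything glues two paths of the cover into one.\<close>
lemma path_cover_absorb:
  assumes "symp E" "path_cover E ps S" "distinct vs" "S \<inter> set vs = {}"
    and "\<And>u v. u \<in> S \<union> set vs \<Longrightarrow> v \<in> set vs \<Longrightarrow> u \<noteq> v \<Longrightarrow> E u v"
  shows "\<exists>qs. path_cover E qs (S \<union> set vs) \<and> length qs \<le> max 1 (length ps - length vs)"
  using assms(2-)
proof (induction vs arbitrary: ps S)
  case Nil
  then show ?case by auto
next
  case (Cons v vs)
  have v: "v \<notin> S" "v \<notin> set vs" using Cons.prems by auto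
  have adj: "E u v" "E v u" if "u \<in> S" for u
    using Cons.prems(4)[of u v] that v sympD[OF assms(1)] by auto
  have "\<exists>rs. path_cover E rs (insert v S) \<and> length rs \<le> max 1 (length ps - 1)"
  \<comment> \<open>The vertex \<open>v\<close> becomes a path of its own, extends the only path, or
    joins the first two paths.\<close>
  proof (cases ps rule: list.exhaust[case_names N C])
    case N
    then have "S = {}" using Cons.prems by (auto simp: path_cover_def)
    then show ?thesis by (intro exI[of _ "[[v]]"]) (auto simp: path_cover_def)
  next
    case (C p ps')
    have p: "p \<noteq> []" "successively E p" "last p \<in> S" "v \<notin> set p"
      using C Cons.prems(1) v by (auto simp: path_cover_def)
    show ?thesis
    proof (cases ps' rule: list.exhaust[case_names N C])
      case N
      then show ?thesis using C Cons.prems p adj v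
        by (intro exI[of _ "[p @ [v]]"]) (auto simp: path_cover_def successively_append_iff)
    next
      case C': (C p' ps'')
      have p': "p' \<noteq> []" "successively E p'" "hd p' \<in> S"
        using C C' Cons.prems(1) by (auto simp: path_cover_def)
      show ?thesis using C C' Cons.prems(1) p p' adj v
        by (intro exI[of _ "(p @ v # p') # ps''"])
           (auto simp: path_cover_def successively_append_iff successively_Cons)
    qed
  qed
  then obtain rs where rs: "path_cover E rs (insert v S)" "length rs \<le> max 1 (length ps - 1)" by blast
  have "\<exists>qs. path_cover E qs (insert v S \<union> set vs) \<and> length qs \<le> max 1 (length rs - length vs)"
    using Cons.prems v rs(1) by (intro Cons.IH) auto
  then obtain qs where qs: "path_cover E qs (insert v S \<union> set vs)" "length qs \<le> max 1 (length rs - length vs)"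
    by blast
  have "length qs \<le> max 1 (length ps - length (v # vs))" using qs(2) rs(2) by auto
  then show ?case using qs(1) by (intro exI[of _ qs]) auto
qed

text \<open>Two hubs are held back to serve as the ends. The remaining ones are at least as many as
  the paths and merge everything into at most one path.\<close>

lemma hamilton_path_with_hub_ends:
  assumes "symp E" "path_cover E ps S" "distinct vs" "S \<inter> set vs = {}"
    and adj: "\<And>u v. u \<in> S \<union> set vs \<Longrightarrow> v \<in> set vs \<Longrightarrow> u \<noteq> v \<Longrightarrow> E u v"
    and len: "length ps + 2 \<le> length vs"
  shows "\<exists>q. q \<noteq> [] \<and> successively E q \<and> distinct q \<and> set q = S \<union> set vs \<and> hd q \<in> set vs \<and> last q \<in> set vs"
proof -
  obtain v w vs' where vs: "vs = v # w # vs'"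
    using len by (cases vs; cases "tl vs") auto
  have "\<exists>qs. path_cover E qs (S \<union> set vs') \<and> length qs \<le> max 1 (length ps - length vs')"
    using assms vs by (intro path_cover_absorb) auto
  then obtain qs where qs: "path_cover E qs (S \<union> set vs')" "length qs \<le> 1"
    using len vs by auto
  define p where "p = concat qs"
  have p: "successively E p" "distinct p" "set p = S \<union> set vs'"
    using qs by (auto simp: path_cover_def p_def le_Suc_eq length_Suc_conv)
  have "E v (hd p)" "E (last p) w" if "p \<noteq> []"
  proof -
    have "hd p \<in> S \<union> set vs'" "last p \<in> S \<union> set vs'" using p(3) hd_in_set[OF that] last_in_set[OF that] by blast+
    moreover have "v \<notin> S \<union> set vs'" "w \<notin> S \<union> set vs'" using vs assms(3,4) by auto
    ultimately show "E v (hd p)" "E (last p) w"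
      using adj[of "hd p" v] adj[of "last p" w] vs sympD[OF assms(1), of "hd p" v] by auto
  qed
  moreover have "E v w" using adj[of v w] vs assms(3) by auto
  ultimately show ?thesis using p vs assms(3,4)
    by (intro exI[of _ "v # p @ [w]"]) (auto simp: successively_append_iff successively_Cons hd_append)
qed

lemma has_hamilton_cycleI:
  assumes "3 \<le> n" "distinct xs" "set xs = {0..<n}" "successively E xs" "E (last xs) (hd xs)"
  shows "has_hamilton_cycle n E"
proof -
  have len: "length xs = n" using assms distinct_card[of xs] by simp
  have "bij_betw (\<lambda>k. xs ! k) {0..<n} {0..<n}"
    using assms(2,3) len by (intro bij_betw_nth) (simp_all add: lessThan_atLeast0)
  moreover have "E (xs ! k) (xs ! ((k + 1) mod n))" if "k < n" for k
  proof (cases "k + 1 < n")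
    case True
    then show ?thesis using assms(4) len by (simp add: successively_conv_nth)
  next
    case False
    then have "k = n - 1" using that by simp
    moreover have "xs \<noteq> []" using assms by auto
    ultimately show ?thesis using assms len that by (simp add: last_conv_nth hd_conv_nth)
  qed
  ultimately show ?thesis using assms unfolding has_hamilton_cycle_def by blast
qed

text \<open>All path ends lie in the clique \<open>H\<close>, so each path can be followed by the
  next, and the last by the first.\<close>

lemma has_hamilton_cycle_concat:
  fixes q :: "nat \<Rightarrow> nat list"
  assumes "3 \<le> n" "D > 0"
    and q: "\<And>j. j < D \<Longrightarrow> q j \<noteq> [] \<and> successively E (q j) \<and> distinct (q j) \<and> set (q j) = S j
       \<and> hd (q j) \<in> H \<and> last (q j) \<in> H"
    and disj: "\<And>i j. i < j \<Longrightarrow> j < D \<Longrightarrow> S i \<inter> S j = {}"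
    and un: "(\<Union>j<D. S j) = {0..<n}"
    and H: "\<And>u v. u \<in> H \<Longrightarrow> v \<in> H \<Longrightarrow> u \<noteq> v \<Longrightarrow> E u v"
  shows "has_hamilton_cycle n E"
proof -
  define x where "x d = concat (map q [0..<d])" for d
  have "x d \<noteq> [] \<and> successively E (x d) \<and> distinct (x d) \<and> set (x d) = (\<Union>j<d. S j)
     \<and> hd (x d) = hd (q 0) \<and> last (x d) = last (q (d - 1))"
    if "0 < d" "d \<le> D" for d
    using that
  proof (induction d)
    case (Suc d)
    show ?case
    proof (cases "d = 0")
      case True
      then show ?thesis using q[of 0] Suc.prems by (simp add: x_def lessThan_Suc)
    next
      case False
      then have IH: "x d \<noteq> []" "successively E (x d)" "distinct (x d)" "set (x d) = (\<Union>j<d. S j)"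
        "hd (x d) = hd (q 0)" "last (x d) = last (q (d - 1))" using Suc.IH Suc.prems by simp_all
      have xs: "x (Suc d) = x d @ q d" by (simp add: x_def)
      have qd: "q d \<noteq> []" "successively E (q d)" "distinct (q d)" "set (q d) = S d" "hd (q d) \<in> H"
        using q[of d] Suc.prems by simp_all
      have dj: "set (x d) \<inter> set (q d) = {}"
        using disj[of _ d] Suc.prems IH(4) qd by auto
      have "last (x d) \<in> H" using q[of "d - 1"] Suc.prems False IH by auto
      moreover have "last (x d) \<noteq> hd (q d)"
        using dj IH(1) qd(1) by (metis disjoint_iff last_in_set list.set_sel(1))
      ultimately have "E (last (x d)) (hd (q d))" using H qd by auto
      then show ?thesis using IH qd dj by (auto simp: xs successively_append_iff lessThan_Suc)
    qed
  qed simp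
  from this[of D] have x: "x D \<noteq> []" "successively E (x D)" "distinct (x D)" "set (x D) = {0..<n}"
     "hd (x D) = hd (q 0)" "last (x D) = last (q (D - 1))" using assms by auto
  \<comment> \<open>The clique has edges only between distinct vertices. Equal ends of a distinct
    list would leave a single vertex, contradicting \<open>3 \<le> n\<close>.\<close>
  have "last (x D) \<noteq> hd (x D)"
  proof
    assume e: "last (x D) = hd (x D)"
    have "x D = [hd (x D)]"
      using x(1,3) e by (metis append_Nil append_butlast_last_id distinct_append hd_append2 list.sel(1)
        list.set_intros(1) hd_in_set disjoint_iff)
    then have "card (set (x D)) = 1" by (metis card_1_singleton_iff One_nat_def list.set(1,2))
    then show False using x(4) assms(1) by simp
  qed
  then have "E (last (x D)) (hd (x D))" using H q[of 0] q[of "D - 1"] x assms by auto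
  then show ?thesis using x assms by (intro has_hamilton_cycleI[of n "x D"]) auto
qed

section \<open>Matchings, Hamilton cycles and vertex covers\<close>

lemma near_perfect_matching_if_hamilton_cycle:
  assumes "has_hamilton_cycle n E"
  shows "has_near_perfect_matching n E"
proof -
  obtain \<sigma> where n: "3 \<le> n" and \<sigma>: "bij_betw \<sigma> {0..<n} {0..<n}" and E: "\<And>k. k < n \<Longrightarrow> E (\<sigma> k) (\<sigma> ((k + 1) mod n))"
    using assms by (auto simp: has_hamilton_cycle_def)
  have inj: "\<sigma> a = \<sigma> b \<longleftrightarrow> a = b" if "a < n" "b < n" for a b
    using \<sigma> that by (auto simp: bij_betw_def inj_on_def)
  have lt: "\<sigma> a < n" if "a < n" for a using bij_betwE[OF \<sigma>] that by auto
  \<comment> \<open>Every second edge of the cycle; only \<open>\<sigma> (n - 1)\<close> can stay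
    uncovered.\<close>
  define M where "M = (\<lambda>k. {\<sigma> (2 * k), \<sigma> (2 * k + 1)}) ` {k. 2 * k + 1 < n}"
  have "is_matching n E M"
    unfolding is_matching_def
  proof (intro conjI ballI impI)
    fix e assume "e \<in> M"
    then obtain k where k: "e = {\<sigma> (2 * k), \<sigma> (2 * k + 1)}" "2 * k + 1 < n" by (auto simp: M_def)
    moreover have "E (\<sigma> (2 * k)) (\<sigma> (2 * k + 1))" using E[of "2 * k"] k by simp
    ultimately show "\<exists>i j. e = {i, j} \<and> i < n \<and> j < n \<and> E i j"
      using lt[of "2 * k"] lt[of "2 * k + 1"] by (intro exI[of _ "\<sigma> (2 * k)"] exI[of _ "\<sigma> (2 * k + 1)"]) auto
  next
    fix e e' assume "e \<in> M" "e' \<in> M" "e \<noteq> e'"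
    then obtain k l where k: "e = {\<sigma> (2 * k), \<sigma> (2 * k + 1)}" "2 * k + 1 < n"
      and l: "e' = {\<sigma> (2 * l), \<sigma> (2 * l + 1)}" "2 * l + 1 < n" by (auto simp: M_def)
    have "k \<noteq> l" using k l \<open>e \<noteq> e'\<close> by auto
    moreover have "2 * k \<noteq> 2 * l + 1" "2 * k + 1 \<noteq> 2 * l" by presburger+
    ultimately show "e \<inter> e' = {}" using k l inj by auto
  qed
  moreover have "{0..<n} - \<Union>M \<subseteq> {\<sigma> (n - 1)}"
  proof
    fix v assume v: "v \<in> {0..<n} - \<Union>M"
    then have "v \<in> \<sigma> ` {0..<n}" using \<sigma> by (simp add: bij_betw_def)
    then obtain a where a: "a < n" "v = \<sigma> a" by auto
    show "v \<in> {\<sigma> (n - 1)}"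
    proof (cases "a = n - 1")
      case False
      then have "2 * (a div 2) + 1 < n" using a by presburger
      then have "{\<sigma> (2 * (a div 2)), \<sigma> (2 * (a div 2) + 1)} \<in> M" by (auto simp: M_def)
      moreover have "a = 2 * (a div 2) \<or> a = 2 * (a div 2) + 1" by presburger
      ultimately have "v \<in> \<Union>M" using a by (metis UnionI insertI1 insertI2)
      then show ?thesis using v by simp
    qed (use a in simp)
  qed
  then have "card ({0..<n} - \<Union>M) \<le> card {\<sigma> (n - 1)}" by (intro card_mono) auto
  ultimately show ?thesis unfolding has_near_perfect_matching_def by (intro exI[of _ M]) simp
qed

text \<open>Each edge of a matching contains a vertex of \<open>B\<close> of its own, so fewer than
  \<open>2 * n / 3\<close> vertices are matched. More than \<open>n / 3 \<ge> 1\<close> vertices are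
  left, hence at least two.\<close>

lemma no_near_perfect_matching_if_small_vertex_cover:
  assumes n: "3 \<le> n" and irr: "\<And>i. \<not> E i i"
    and B: "\<And>i j. i < n \<Longrightarrow> j < n \<Longrightarrow> E i j \<Longrightarrow> i \<in> B \<or> j \<in> B"
    and card: "3 * card (B \<inter> {0..<n}) < n"
  shows "\<not> has_near_perfect_matching n E"
proof
  assume "has_near_perfect_matching n E"
  then obtain M where M: "is_matching n E M" "card ({0..<n} - \<Union>M) \<le> 1"
    by (auto simp: has_near_perfect_matching_def)
  have sub: "e \<subseteq> {0..<n} \<and> card e \<le> 2 \<and> e \<inter> B \<noteq> {}" if "e \<in> M" for e
  proof -
    have "\<exists>i j. e = {i, j} \<and> i < n \<and> j < n \<and> E i j"
      using M(1) that unfolding is_matching_def by simp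
    then obtain i j where ij: "e = {i, j}" "i < n" "j < n" "E i j" by blast
    then show ?thesis using B[OF ij(2-4)] by (auto simp: card_insert_if)
  qed
  have fM: "finite M" using sub by (intro finite_subset[of M "Pow {0..<n}"]) auto
  have "\<exists>f. \<forall>e\<in>M. f e \<in> e \<inter> B" using sub by (intro bchoice) blast
  then obtain f where f: "\<And>e. e \<in> M \<Longrightarrow> f e \<in> e \<inter> B" by blast
  have "inj_on f M"
  proof (rule inj_onI, rule ccontr)
    fix e e' assume "e \<in> M" "e' \<in> M" "f e = f e'" "e \<noteq> e'"
    then show False using f[of e] f[of e'] M(1) unfolding is_matching_def by (metis IntD1 disjoint_iff)
  qed
  moreover have "f ` M \<subseteq> B \<inter> {0..<n}" using f sub by blast
  ultimately have cM: "card M \<le> card (B \<inter> {0..<n})" by (intro card_inj_on_le) auto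
  have "card (\<Union>M) \<le> (\<Sum>e\<in>M. card e)" by (rule card_Union_le_sum_card)
  also have "\<dots> \<le> (\<Sum>e\<in>M. 2)" using sub by (intro sum_mono) auto
  finally have "card (\<Union>M) \<le> 2 * card (B \<inter> {0..<n})" using cM by simp
  moreover have "card ({0..<n} - \<Union>M) = n - card (\<Union>M)"
    using sub by (subst card_Diff_subset) (auto intro: finite_subset[of _ "{0..<n}"])
  ultimately show False using M(2) n card by linarith
qed

subsection \<open>Graph events\<close>

lemma borel_measurable_hyp_dist [measurable]:
  assumes [measurable]: "f \<in> M \<rightarrow>\<^sub>M borel" "g \<in> M \<rightarrow>\<^sub>M borel"
  shows "(\<lambda>x. hyp_dist (f x) (g x)) \<in> borel_measurable M"
proof -
  have [measurable]: "(cosh :: real \<Rightarrow> real) \<in> borel_measurable borel" "(sinh :: real \<Rightarrow> real) \<in> borel_measurable borel"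
    by (intro borel_measurable_continuous_onI continuous_intros; simp)+
  show ?thesis unfolding hyp_dist_def arcosh_def case_prod_unfold by measurable
qed

text \<open>\<open>Q\<close> only sees the adjacencies among the indices below \<open>n\<close>, so
  the event is a finite union over the edge sets \<open>S\<close> that satisfy
  \<open>Q\<close>.\<close>

lemma graph_event_measurable:
  fixes Q :: "(nat \<Rightarrow> nat \<Rightarrow> bool) \<Rightarrow> bool"
  assumes sets: "sets M = sets (borel :: (real \<times> real) measure)"
    and Q: "\<And>E E'. (\<And>i j. i < n \<Longrightarrow> j < n \<Longrightarrow> E i j = E' i j) \<Longrightarrow> Q E = Q E'"
  defines "P \<equiv> PiM {0..<n} (\<lambda>_. M)"
  shows "{x \<in> space P. Q (kpkvb_adj R x)} \<in> sets P"
proof -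
  define F where "F = {S. S \<subseteq> {..<n} \<times> {..<n} \<and> Q (\<lambda>i j. (i, j) \<in> S)}"
  have [measurable_cong]: "sets M = sets borel" by (rule sets)
  have "{x \<in> space P. Q (kpkvb_adj R x)} =
     (\<Union>S\<in>F. {x \<in> space P. \<forall>p\<in>{..<n} \<times> {..<n}. kpkvb_adj R x (fst p) (snd p) \<longleftrightarrow> p \<in> S})"
    (is "?L = ?R")
  proof (intro equalityI subsetI)
    fix x assume x: "x \<in> ?L"
    let ?S = "{p \<in> {..<n} \<times> {..<n}. kpkvb_adj R x (fst p) (snd p)}"
    have "Q (\<lambda>i j. (i, j) \<in> ?S) = Q (kpkvb_adj R x)" by (rule Q) simp
    then have "?S \<in> F" using x by (simp add: F_def) 
    then show "x \<in> ?R" using x by (intro UN_I[of ?S]) auto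
  next
    fix x assume "x \<in> ?R"
    then obtain S where S: "S \<in> F" "x \<in> space P"
      "\<forall>p\<in>{..<n} \<times> {..<n}. kpkvb_adj R x (fst p) (snd p) \<longleftrightarrow> p \<in> S" by blast
    have "Q (\<lambda>i j. (i, j) \<in> S) = Q (kpkvb_adj R x)"
      by (rule Q) (use S(3) in auto)
    then show "x \<in> ?L" using S by (simp add: F_def)
  qed
  moreover have "finite F" unfolding F_def by (rule finite_subset[of _ "Pow ({..<n} \<times> {..<n})"]) auto
  moreover have "{x \<in> space P. \<forall>p\<in>{..<n} \<times> {..<n}. kpkvb_adj R x (fst p) (snd p) \<longleftrightarrow> p \<in> S} \<in> sets P" for S
  proof -
    have "{x \<in> space P. kpkvb_adj R x i j \<longleftrightarrow> (i, j) \<in> S} \<in> sets P" if "i < n" "j < n" for i j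
    proof -
      have [measurable]: "(\<lambda>x. x i) \<in> P \<rightarrow>\<^sub>M borel" "(\<lambda>x. x j) \<in> P \<rightarrow>\<^sub>M borel"
        using that measurable_component_singleton[of _ "{0..<n}" "\<lambda>_. M"] measurable_cong_sets[OF refl sets, of P]
        unfolding P_def by auto
      show ?thesis unfolding kpkvb_adj_def by measurable
    qed
    then show ?thesis by (intro sets.sets_Collect_finite_All) auto
  qed
  ultimately show ?thesis by auto
qed

lemma has_hamilton_cycle_cong:
  assumes "\<And>i j. i < n \<Longrightarrow> j < n \<Longrightarrow> E i j = E' i j"
  shows "has_hamilton_cycle n E = has_hamilton_cycle n E'"
proof -
  have "has_hamilton_cycle n E'" if "has_hamilton_cycle n E"
    and eq: "\<And>i j. i < n \<Longrightarrow> j < n \<Longrightarrow> E i j = E' i j" for E E'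
  proof -
    from that(1) obtain \<sigma> where \<sigma>: "3 \<le> n" "bij_betw \<sigma> {0..<n} {0..<n}" "\<forall>k<n. E (\<sigma> k) (\<sigma> ((k + 1) mod n))"
      by (auto simp: has_hamilton_cycle_def)
    have "\<sigma> k < n" if "k < n" for k using bij_betwE[OF \<sigma>(2)] that by auto
    then have "\<forall>k<n. E' (\<sigma> k) (\<sigma> ((k + 1) mod n))" using \<sigma> eq by auto
    then show ?thesis using \<sigma> unfolding has_hamilton_cycle_def by blast
  qed
  from this[of E E'] this[of E' E] assms show ?thesis by blast
qed

lemma has_near_perfect_matching_cong:
  assumes "\<And>i j. i < n \<Longrightarrow> j < n \<Longrightarrow> E i j = E' i j"
  shows "has_near_perfect_matching n E = has_near_perfect_matching n E'"
proof -
  have "(\<exists>i j. e = {i, j} \<and> i < n \<and> j < n \<and> E i j) \<longleftrightarrow> (\<exists>i j. e = {i, j} \<and> i < n \<and> j < n \<and> E' i j)" for e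
    using assms by blast
  then have "is_matching n E M = is_matching n E' M" for M
    by (simp only: is_matching_def)
  then show ?thesis by (simp add: has_near_perfect_matching_def)
qed

lemma hyp_dist_commute: "hyp_dist p q = hyp_dist q p"
  by (cases p; cases q) (simp add: hyp_dist_def mult.commute cos_diff)

lemma kpkvb_adj_symp: "symp (kpkvb_adj R x)"
  by (auto simp: symp_def kpkvb_adj_def hyp_dist_commute)

section \<open>The growing radius and criteria for asymptotically almost sure events\<close>

lemma kpkvb_R_at_top:
  assumes "0 < \<nu>"
  shows "filterlim (kpkvb_R \<nu>) at_top sequentially"
proof -
  have "filterlim (\<lambda>n. real n * (1 / \<nu>)) at_top sequentially"
    using assms by (intro filterlim_at_top_mult_tendsto_pos[OF tendsto_const] filterlim_real_sequentially) auto
  then have "filterlim (\<lambda>n. ln (real n / \<nu>)) at_top sequentially"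
    by (intro filterlim_compose[OF ln_at_top]) simp
  then show ?thesis unfolding kpkvb_R_def[abs_def]
    by (intro filterlim_tendsto_pos_mult_at_top[OF tendsto_const]) auto
qed

lemma exp_kpkvb_R_half:
  assumes "0 < \<nu>" "0 < n"
  shows "exp (kpkvb_R \<nu> n / 2) = real n / \<nu>"
  using assms by (simp add: kpkvb_R_def)

text \<open>It suffices to derive \<open>Q\<close> outside an exceptional event \<open>A\<close> of
  vanishing probability. All points may be taken inside the disk, because this holds almost
  surely.\<close>

lemma kpkvb_aasI:
  assumes "0 < \<alpha>" "0 < \<nu>"
    and Q: "\<And>n E E'. (\<And>i j. i < n \<Longrightarrow> j < n \<Longrightarrow> E i j = E' i j) \<Longrightarrow> Q n E = Q n E'"
    and g: "g \<longlonglongrightarrow> 0"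
    and ev: "eventually (\<lambda>n. \<exists>A\<in>sets (kpkvb_space n \<alpha> \<nu>). measure (kpkvb_space n \<alpha> \<nu>) A \<le> g n \<and>
      (\<forall>x. (\<forall>i<n. x i \<in> disk_R (kpkvb_R \<nu> n)) \<longrightarrow> x \<in> space (kpkvb_space n \<alpha> \<nu>) \<longrightarrow> x \<notin> A \<longrightarrow> Q n (kpkvb_adj (kpkvb_R \<nu> n) x))) sequentially"
  shows "kpkvb_aas \<alpha> \<nu> Q"
  unfolding kpkvb_aas_def
proof (rule tendsto_sandwich)
  have R: "eventually (\<lambda>n. 0 < kpkvb_R \<nu> n) sequentially"
    using kpkvb_R_at_top[OF assms(2)] by (simp add: filterlim_at_top_dense)
  have "eventually (\<lambda>n. 1 - g n \<le> kpkvb_prob \<alpha> \<nu> Q n \<and> kpkvb_prob \<alpha> \<nu> Q n \<le> 1) sequentially"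
    using ev R
  proof eventually_elim
    case (elim n)
    let ?P = "kpkvb_space n \<alpha> \<nu>" and ?R = "kpkvb_R \<nu> n"
    have ps: "prob_space (point_measure \<alpha> ?R)" using assms(1) elim(2) by (intro prob_space_point_measure) auto
    interpret P: prob_space ?P unfolding kpkvb_space_def by (intro prob_space_PiM ps)
    obtain A where A: "A \<in> P.events" "P.prob A \<le> g n"
      "\<And>x. (\<forall>i<n. x i \<in> disk_R ?R) \<Longrightarrow> x \<in> space ?P \<Longrightarrow> x \<notin> A \<Longrightarrow> Q n (kpkvb_adj ?R x)"
      using elim by blast
    let ?G = "{x \<in> space ?P. Q n (kpkvb_adj ?R x)}"
    have G: "?G \<in> P.events"
      unfolding kpkvb_space_def by (rule graph_event_measurable[OF _ Q]) simp_all
    have "AE x in ?P. \<forall>i\<in>{0..<n}. x i \<in> disk_R ?R"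
      unfolding kpkvb_space_def using assms(1) elim(2)
      by (intro AE_finite_allI AE_PiM_component AE_point_measure_disk ps) auto
    then have "AE x in ?P. x \<in> space ?P - ?G \<longrightarrow> x \<in> A"
    proof eventually_elim
      case (elim x)
      then show ?case using A(3)[of x] by auto
    qed
    then have "P.prob (space ?P - ?G) \<le> P.prob A"
      using A(1) by (rule P.finite_measure_mono_AE)
    then have "1 - g n \<le> P.prob ?G" using P.prob_compl[OF G] A(2) by simp
    then show ?case by (simp add: kpkvb_prob_def)
  qed
  then show "eventually (\<lambda>n. 1 - g n \<le> kpkvb_prob \<alpha> \<nu> Q n) sequentially"
    "eventually (\<lambda>n. kpkvb_prob \<alpha> \<nu> Q n \<le> 1) sequentially"
    by (auto elim: eventually_mono)
  show "(\<lambda>n. 1 - g n) \<longlonglongrightarrow> 1" using tendsto_diff[OF tendsto_const g, of 1] by simp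
qed auto

text \<open>The failure of \<open>Q\<close> serves as the exceptional event in
  \<open>kpkvb_aasI\<close>.\<close>

lemma kpkvb_aas_mono:
  assumes "0 < \<alpha>" "0 < \<nu>" "kpkvb_aas \<alpha> \<nu> Q"
    and "\<And>n E. Q n E \<Longrightarrow> Q' n E"
    and Q: "\<And>n E E'. (\<And>i j. i < n \<Longrightarrow> j < n \<Longrightarrow> E i j = E' i j) \<Longrightarrow> Q n E = Q n E'"
    and Q': "\<And>n E E'. (\<And>i j. i < n \<Longrightarrow> j < n \<Longrightarrow> E i j = E' i j) \<Longrightarrow> Q' n E = Q' n E'"
  shows "kpkvb_aas \<alpha> \<nu> Q'"
proof (rule kpkvb_aasI[OF assms(1,2) Q'])
  show "(\<lambda>n. 1 - kpkvb_prob \<alpha> \<nu> Q n) \<longlonglongrightarrow> 0"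
    using tendsto_diff[OF tendsto_const[of 1] assms(3)[unfolded kpkvb_aas_def]] by simp
  have R: "eventually (\<lambda>n. 0 < kpkvb_R \<nu> n) sequentially"
    using kpkvb_R_at_top[OF assms(2)] by (simp add: filterlim_at_top_dense)
  then show "eventually (\<lambda>n. \<exists>A\<in>sets (kpkvb_space n \<alpha> \<nu>). measure (kpkvb_space n \<alpha> \<nu>) A \<le> 1 - kpkvb_prob \<alpha> \<nu> Q n \<and>
      (\<forall>x. (\<forall>i<n. x i \<in> disk_R (kpkvb_R \<nu> n)) \<longrightarrow> x \<in> space (kpkvb_space n \<alpha> \<nu>) \<longrightarrow> x \<notin> A \<longrightarrow> Q' n (kpkvb_adj (kpkvb_R \<nu> n) x))) sequentially"
  proof eventually_elim
    case (elim n)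
    let ?P = "kpkvb_space n \<alpha> \<nu>" and ?R = "kpkvb_R \<nu> n"
    interpret P: prob_space ?P unfolding kpkvb_space_def using assms(1) elim
      by (intro prob_space_PiM prob_space_point_measure) auto
    let ?G = "{x \<in> space ?P. Q n (kpkvb_adj ?R x)}"
    have G: "?G \<in> P.events"
      unfolding kpkvb_space_def by (rule graph_event_measurable[OF _ Q]) simp_all
    then show ?case using P.prob_compl[OF G] assms(4)
      by (intro bexI[of _ "space ?P - ?G"]) (auto simp: kpkvb_prob_def)
  qed
qed

subsection \<open>Small intensity\<close>

text \<open>Revealing the points one at a time, each one is bad with conditional probability at most \<open>q\<close>.\<close>
lemma (in prob_space) sequential_bad_count_prob:
  fixes bad :: "nat \<Rightarrow> (nat \<Rightarrow> 'a) \<Rightarrow> 'a \<Rightarrow> bool"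
  assumes meas: "\<And>m. (\<lambda>(x, y). bad m x y) \<in> measurable (PiM {0..<m} (\<lambda>_. M) \<Otimes>\<^sub>M M) (count_space UNIV)"
    and dep: "\<And>m x x' y. (\<And>i. i < m \<Longrightarrow> x i = x' i) \<Longrightarrow> bad m x y = bad m x' y"
    and q: "\<And>m x. m < n \<Longrightarrow> x \<in> space (PiM {0..<m} (\<lambda>_. M)) \<Longrightarrow> prob {y \<in> space M. bad m x y} \<le> q" "0 \<le> q"
  defines "P \<equiv> \<lambda>m. PiM {0..<m} (\<lambda>_. M)"
  shows "{x \<in> space (P n). a \<le> real (card {i. i < n \<and> bad i x (x i)})} \<in> sets (P n)"
    and "measure (P n) {x \<in> space (P n). a \<le> real (card {i. i < n \<and> bad i x (x i)})} \<le> exp (2 * q * real n - a)"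
proof -
  interpret S: product_sigma_finite "\<lambda>_::nat. M" ..
  have prob_P: "prob_space (P m)" for m unfolding P_def by (intro prob_space_PiM prob_space_axioms)
  define B where "B m x = card {i. i < m \<and> bad i x (x i)}" for m x
  define Z where "Z m x = exp (real (B m x))" for m x
  have bad_meas: "{x \<in> space (P m). bad i x (x i)} \<in> sets (P m)" if "i < m" for i m
  proof -
    \<comment> \<open>\<open>bad i\<close> reads only the first \<open>i\<close> coordinates, so it
      can be evaluated on the restriction, where \<open>meas\<close> applies.\<close>
    have "(\<lambda>x. (restrict x {0..<i}, x i)) \<in> P m \<rightarrow>\<^sub>M PiM {0..<i} (\<lambda>_. M) \<Otimes>\<^sub>M M"
      unfolding P_def using that by (intro measurable_Pair measurable_restrict_subset measurable_component_singleton) auto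
    from measurable_compose[OF this meas[of i]]
    have "{x \<in> space (P m). bad i (restrict x {0..<i}) (x i)} \<in> sets (P m)"
      by (simp add: pred_def)
    moreover have "bad i (restrict x {0..<i}) (x i) = bad i x (x i)" for x by (rule dep) simp
    ultimately show ?thesis by simp
  qed
  have B_eq: "real (B m x) = (\<Sum>i\<in>{0..<m}. of_bool (bad i x (x i)))" for m x
    by (auto simp: B_def sum_of_bool_eq intro!: arg_cong[of _ _ card])
  have B_meas [measurable]: "(\<lambda>x. real (B m x)) \<in> borel_measurable (P m)" for m
  proof -
    have "(\<lambda>x. of_bool (bad i x (x i)) :: real) \<in> borel_measurable (P m)" if "i < m" for i
      using bad_meas[OF that] by (simp add: of_bool_def measurable_If pred_def)
    then show ?thesis unfolding B_eq by (intro borel_measurable_sum) auto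
  qed
  then have Z_meas [measurable]: "Z m \<in> borel_measurable (P m)" for m
    unfolding Z_def[abs_def] by measurable
  have e: "exp 1 - 1 \<le> (2::real)" using exp_le by simp
  have e1: "ennreal (exp 1) = 1 + ennreal (exp 1 - 1)"
    using ennreal_plus[of 1 "exp 1 - 1"] by simp
  \<comment> \<open>The newest point is integrated first, with the earlier ones fixed. Its factor
    has mean at most \<open>1 + (exp 1 - 1) * q \<le> 1 + 2 * q\<close>, whatever the past
    is.\<close>
  have step: "(\<integral>\<^sup>+x. ennreal (Z m x) \<partial>P m) \<le> ennreal (1 + 2 * q) ^ m" if "m \<le> n" for m
    using that
  proof (induction m)
    case 0
    interpret P0: prob_space "P 0" by (rule prob_P)
    show ?case by (simp add: Z_def B_def P0.emeasure_space_1)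
  next
    case (Suc m)
    have ZS: "Z (Suc m) (x(m := y)) = Z m x * exp (of_bool (bad m x y))" for x y
    proof -
      have *: "bad i (x(m := y)) z = bad i x z" if "i \<le> m" for i z using that by (intro dep) auto
      have "real (B (Suc m) (x(m := y))) = real (B m x) + of_bool (bad m x y)"
      proof -
        have "(\<Sum>i\<in>{0..<m}. of_bool (bad i (x(m := y)) ((x(m := y)) i)) :: real) = (\<Sum>i\<in>{0..<m}. of_bool (bad i x (x i)))"
          using * by (intro sum.cong) auto
        then show ?thesis using *[of m] by (simp add: B_eq del: sum_of_bool_eq)
      qed
      then show ?thesis by (simp add: Z_def exp_add)
    qed
    have "(\<integral>\<^sup>+x. ennreal (Z (Suc m) x) \<partial>P (Suc m)) =
       (\<integral>\<^sup>+x. \<integral>\<^sup>+y. ennreal (Z (Suc m) (x(m := y))) \<partial>M \<partial>P m)"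
      unfolding P_def atLeast0_lessThan_Suc using Z_meas[of "Suc m"]
      by (subst S.product_nn_integral_insert) (auto simp: P_def atLeast0_lessThan_Suc)
    also have "\<dots> \<le> (\<integral>\<^sup>+x. ennreal (Z m x) * ennreal (1 + 2 * q) \<partial>P m)"
    proof (rule nn_integral_mono)
      fix x assume x: "x \<in> space (P m)"
      have A: "{y \<in> space M. bad m x y} \<in> sets M"
        using measurable_compose[OF measurable_Pair1' meas[of m]] x by (simp add: P_def pred_def)
      have "(\<integral>\<^sup>+y. ennreal (exp (of_bool (bad m x y))) \<partial>M)
          = (\<integral>\<^sup>+y. 1 + ennreal (exp 1 - 1) * indicator {y \<in> space M. bad m x y} y \<partial>M)"
        by (intro nn_integral_cong) (auto simp: indicator_def e1)
      also have "\<dots> = 1 + ennreal (exp 1 - 1) * emeasure M {y \<in> space M. bad m x y}"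
        using A by (subst nn_integral_add) (auto simp: emeasure_space_1 nn_integral_cmult_indicator)
      also have "\<dots> = ennreal (1 + (exp 1 - 1) * prob {y \<in> space M. bad m x y})"
        by (simp add: emeasure_eq_measure ennreal_mult)
      also have "\<dots> \<le> ennreal (1 + 2 * q)"
        using q(1)[of m x] q(2) x Suc.prems e by (intro ennreal_leI add_left_mono mult_mono) (auto simp: P_def)
      finally have "(\<integral>\<^sup>+y. ennreal (exp (of_bool (bad m x y))) \<partial>M) \<le> ennreal (1 + 2 * q)" .
      moreover have "(\<integral>\<^sup>+y. ennreal (Z (Suc m) (x(m := y))) \<partial>M) = ennreal (Z m x) * (\<integral>\<^sup>+y. ennreal (exp (of_bool (bad m x y))) \<partial>M)"
        unfolding ZS using A
        by (subst nn_integral_cmult[symmetric]) (auto simp: ennreal_mult Z_def of_bool_def pred_def intro!: nn_integral_cong)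
      ultimately show "(\<integral>\<^sup>+y. ennreal (Z (Suc m) (x(m := y))) \<partial>M) \<le> ennreal (Z m x) * ennreal (1 + 2 * q)"
        by (simp add: mult_left_mono)
    qed
    also have "\<dots> = (\<integral>\<^sup>+x. ennreal (Z m x) \<partial>P m) * ennreal (1 + 2 * q)"
      by (rule nn_integral_multc) simp
    also have "\<dots> \<le> ennreal (1 + 2 * q) ^ m * ennreal (1 + 2 * q)"
      using Suc by (intro mult_right_mono) auto
    finally show ?case by (simp add: mult.commute)
  qed
  interpret Pn: prob_space "P n" by (rule prob_P)
  show "{x \<in> space (P n). a \<le> real (card {i. i < n \<and> bad i x (x i)})} \<in> sets (P n)"
    using B_meas[of n] unfolding B_def by measurable
  show "measure (P n) {x \<in> space (P n). a \<le> real (card {i. i < n \<and> bad i x (x i)})} \<le> exp (2 * q * real n - a)"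
  proof -
    \<comment> \<open>A Chernoff bound: Markov's inequality for the exponential moment
      \<open>Z n\<close>.\<close>
    have "emeasure (P n) {x \<in> space (P n). a \<le> real (B n x)} =
        emeasure (P n) {x \<in> space (P n). 1 \<le> ennreal (exp (- a)) * ennreal (Z n x)}"
      by (intro arg_cong[of _ _ "emeasure (P n)"] Collect_cong)
         (auto simp: Z_def ennreal_mult[symmetric] exp_add[symmetric] simp flip: ennreal_1)
    also have "\<dots> \<le> ennreal (exp (- a)) * (\<integral>\<^sup>+x. ennreal (Z n x) * indicator (space (P n)) x \<partial>P n)"
      by (rule order_trans[OF _ nn_integral_Markov_inequality]) auto
    also have "\<dots> \<le> ennreal (exp (- a)) * ennreal (1 + 2 * q) ^ n"
      using step[of n] by (intro mult_left_mono) (auto cong: nn_integral_cong)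
    also have "\<dots> \<le> ennreal (exp (- a)) * ennreal (exp (2 * q)) ^ n"
      by (intro mult_left_mono power_mono ennreal_leI exp_ge_add_one_self) auto
    also have "\<dots> = ennreal (exp (2 * q * real n - a))"
      by (simp add: ennreal_power ennreal_mult[symmetric] exp_of_nat_mult[symmetric] exp_add[symmetric] algebra_simps)
    finally show ?thesis unfolding B_def measure_def by (intro enn2real_leI) auto
  qed
qed

text \<open>Of two adjacent points near the boundary, the later one satisfies the last disjunct. Hence the
  points that are deep or close in angle to an earlier point form a vertex cover.\<close>
definition late_or_deep :: "real \<Rightarrow> real \<Rightarrow> nat \<Rightarrow> (nat \<Rightarrow> real \<times> real) \<Rightarrow> real \<times> real \<Rightarrow> bool" where
  "late_or_deep r \<delta> m x y \<longleftrightarrow> fst y < r \<or>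
     (\<exists>i\<in>{0..<m}. \<exists>k\<in>{-2 * pi, 0, 2 * pi}. \<bar>snd (x i) - snd y - k\<bar> \<le> \<delta>)"

text \<open>A union bound over the deep region and three angular windows of width
  \<open>2 * \<delta>\<close> for each of the \<open>m\<close> earlier points; a window has mass at
  most \<open>\<delta> / pi\<close>.\<close>

lemma late_or_deep_prob:
  assumes "0 < \<alpha>" "0 < R" "0 \<le> C" "0 \<le> \<delta>"
  shows "measure (point_measure \<alpha> R) {y. late_or_deep (R - C) \<delta> m x y} \<le> exp (- \<alpha> * C) + real m * (3 * \<delta> / pi)"
proof -
  interpret prob_space "point_measure \<alpha> R" using assms by (intro prob_space_point_measure)
  define K where "K = {-2 * pi, 0, 2 * pi}"
  define A where "A = (\<lambda>i k. {y :: real \<times> real. snd y \<in> {snd (x i) - k - \<delta>..snd (x i) - k + \<delta>}})"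
  have A: "A i k \<in> events" "prob (A i k) \<le> \<delta> / pi" for i k
  proof -
    show "A i k \<in> events" unfolding A_def by measurable
    show "prob (A i k) \<le> \<delta> / pi"
      unfolding A_def using assms by (intro order_trans[OF measure_point_measure_angle_le]) auto
  qed
  have fK: "finite K" "card K \<le> 3" by (auto simp: K_def card_insert_if)
  have "{y. late_or_deep (R - C) \<delta> m x y} = {y. fst y < R - C} \<union> (\<Union>i\<in>{0..<m}. \<Union>k\<in>K. A i k)"
    by (auto simp: late_or_deep_def A_def K_def abs_le_iff algebra_simps) 
  also have "prob \<dots> \<le> prob {y. fst y < R - C} + prob (\<Union>i\<in>{0..<m}. \<Union>k\<in>K. A i k)"
    using A(1) fK(1) by (intro measure_Un_le) (auto intro!: sets.finite_UN)
  also have "prob (\<Union>i\<in>{0..<m}. \<Union>k\<in>K. A i k) \<le> (\<Sum>i\<in>{0..<m}. prob (\<Union>k\<in>K. A i k))"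
    using A(1) fK(1) by (intro measure_UNION_le) (auto intro!: sets.finite_UN)
  also have "\<dots> \<le> (\<Sum>i\<in>{0..<m}. \<Sum>k\<in>K. prob (A i k))"
    using A(1) fK(1) by (intro sum_mono measure_UNION_le) auto
  also have "\<dots> \<le> (\<Sum>i\<in>{0..<m}. \<Sum>k\<in>K. \<delta> / pi)" by (intro sum_mono A(2))
  also have "\<dots> = real m * (real (card K) * (\<delta> / pi))" by simp
  also have "\<dots> \<le> real m * (3 * (\<delta> / pi))"
    using fK(2) assms by (intro mult_left_mono mult_right_mono) auto
  finally show ?thesis using measure_point_measure_radius_less[OF assms(1-3)] by simp
qed

text \<open>\<open>C\<close> makes a point deep with probability at most 1/16, and the bound on
  \<open>\<nu>\<close> makes \<open>n * \<delta> = 16 * exp C * \<nu>\<close> less than 1/16. So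
  \<open>q = 1 / 8\<close>, and \<open>n / 3\<close> bad points occur with probability at most
  \<open>exp (n / 4 - n / 3)\<close>.\<close>

lemma no_near_perfect_matching_aas:
  assumes "0 < \<alpha>" "0 < \<nu>" and C: "C = ln 16 / \<alpha>" and \<nu>: "256 * exp C * \<nu> < 1"
  shows "kpkvb_aas \<alpha> \<nu> (\<lambda>n E. \<not> has_near_perfect_matching n E)"
proof (rule kpkvb_aasI[OF assms(1,2)])
  show "(\<not> has_near_perfect_matching n E) = (\<not> has_near_perfect_matching n E')"
    if "\<And>i j. i < n \<Longrightarrow> j < n \<Longrightarrow> E i j = E' i j" for n E E'
    using has_near_perfect_matching_cong[OF that] by simp
  show "(\<lambda>n. exp (- (1/12) * real n)) \<longlonglongrightarrow> 0" by real_asymp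
  have C0: "0 \<le> C" using assms by simp
  have "filterlim (kpkvb_R \<nu>) at_top sequentially" using assms(2) by (rule kpkvb_R_at_top)
  then have "eventually (\<lambda>n. C + 1 < kpkvb_R \<nu> n) sequentially" by (simp add: filterlim_at_top_dense)
  moreover have "eventually (\<lambda>n. 16 * exp C * \<nu> \<le> real n) sequentially"
    using filterlim_real_sequentially by (simp add: filterlim_at_top)
  moreover have "eventually (\<lambda>n. 3 \<le> n) sequentially" by (rule eventually_ge_at_top)
  ultimately show "eventually (\<lambda>n. \<exists>A\<in>sets (kpkvb_space n \<alpha> \<nu>). measure (kpkvb_space n \<alpha> \<nu>) A \<le> exp (- (1/12) * real n) \<and>
      (\<forall>x. (\<forall>i<n. x i \<in> disk_R (kpkvb_R \<nu> n)) \<longrightarrow> x \<in> space (kpkvb_space n \<alpha> \<nu>) \<longrightarrow> x \<notin> A \<longrightarrow>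
         \<not> has_near_perfect_matching n (kpkvb_adj (kpkvb_R \<nu> n) x))) sequentially"
  proof eventually_elim
    case (elim n)
    define R where "R = kpkvb_R \<nu> n"
    define \<delta> where "\<delta> = 16 * exp C * exp (- R / 2)"
    have \<delta>: "\<delta> = 16 * exp C * \<nu> / real n"
      using exp_kpkvb_R_half[OF assms(2), of n] elim by (simp add: \<delta>_def R_def exp_minus)
    have R: "C + 1 < R" "0 < R" using elim C0 by (auto simp: R_def)
    interpret M: prob_space "point_measure \<alpha> R" using assms R by (intro prob_space_point_measure)
    let ?bad = "late_or_deep (R - C) \<delta>"
    let ?P = "PiM {0..<n} (\<lambda>_. point_measure \<alpha> R)"
    define A where "A = {x \<in> space ?P. real n / 3 \<le> real (card {i. i < n \<and> ?bad i x (x i)})}"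
    have meas: "(\<lambda>(x, y). ?bad m x y) \<in> measurable (PiM {0..<m} (\<lambda>_. point_measure \<alpha> R) \<Otimes>\<^sub>M point_measure \<alpha> R) (count_space UNIV)" for m
      unfolding late_or_deep_def case_prod_unfold by measurable
    have dep: "?bad m x y = ?bad m x' y" if "\<And>i. i < m \<Longrightarrow> x i = x' i" for m x x' y
      using that by (auto simp: late_or_deep_def)
    have q: "M.prob {y \<in> space (point_measure \<alpha> R). ?bad m x y} \<le> 1 / 8" if "m < n" for m x
    proof -
      have "exp (- \<alpha> * C) = 1 / 16" using assms by (simp add: C exp_minus)
      moreover have "real m * (3 * \<delta> / pi) \<le> 1 / 16"
      proof -
        have "0 \<le> \<delta>" by (simp add: \<delta>_def)
        have "real m * (3 * \<delta> / pi) \<le> real n * (3 * \<delta> / 3)"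
          using that \<open>0 \<le> \<delta>\<close> pi_gt3 by (intro mult_mono divide_left_mono) auto
        also have "\<dots> = 16 * exp C * \<nu>" using elim by (simp add: \<delta>)
        finally show ?thesis using \<nu> by linarith
      qed
      moreover have "M.prob {y. ?bad m x y} \<le> exp (- \<alpha> * C) + real m * (3 * \<delta> / pi)"
        using assms(1) R(2) C0 by (rule late_or_deep_prob) (simp add: \<delta>_def)
      ultimately have "M.prob {y. ?bad m x y} \<le> 1 / 8" by linarith
      then show ?thesis by simp
    qed
    have A: "A \<in> sets ?P"
      unfolding A_def by (rule M.sequential_bad_count_prob(1)[where bad = ?bad and q = "1 / 8"];
        (rule meas | (rule dep; assumption) | (rule q; assumption) | simp))
    have "measure ?P A \<le> exp (2 * (1 / 8) * real n - real n / 3)"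
      unfolding A_def by (rule M.sequential_bad_count_prob(2)[where bad = ?bad and q = "1 / 8"];
        (rule meas | (rule dep; assumption) | (rule q; assumption) | simp))
    also have "2 * (1 / 8) * real n - real n / 3 = - (1 / 12) * real n" by simp
    finally have A': "measure ?P A \<le> exp (- (1 / 12) * real n)" .
    have "\<not> has_near_perfect_matching n (kpkvb_adj R x)"
      if disk: "\<And>i. i < n \<Longrightarrow> x i \<in> disk_R R" and x: "x \<in> space ?P" "x \<notin> A" for x
    proof (rule no_near_perfect_matching_if_small_vertex_cover)
      let ?B = "{i. i < n \<and> ?bad i x (x i)}"
      show "3 \<le> n" using elim by simp
      show "3 * card (?B \<inter> {0..<n}) < n"
      proof -
        have "?B \<inter> {0..<n} = ?B" by auto
        then show ?thesis using x by (simp add: A_def)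
      qed
      \<comment> \<open>If neither point were deep, adjacency would make their angles close, and
        then the later point \<open>j\<close> is bad because of \<open>i\<close>.\<close>
      have cover: "j \<in> ?B" if ij: "i < j" "j < n" "kpkvb_adj R x i j" "i \<notin> ?B" for i j
      proof (cases "?bad j x (x j)")
        case False
        have "\<exists>k\<in>{-2 * pi, 0, 2 * pi}. \<bar>snd (x i) - snd (x j) - k\<bar> \<le> \<delta>"
          unfolding \<delta>_def
        proof (rule angle_small_if_hyp_dist_le)
          show "R - C \<le> fst (x i)" "R - C \<le> fst (x j)"
            using ij False by (auto simp: late_or_deep_def)
          show "fst (x i) \<le> R" "fst (x j) \<le> R" "\<bar>snd (x i) - snd (x j)\<bar> \<le> 2 * pi"
            using disk[of i] disk[of j] ij by (auto simp: disk_R_def)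
          show "hyp_dist (fst (x i), snd (x i)) (fst (x j), snd (x j)) \<le> R"
            using ij by (simp add: kpkvb_adj_def)
          show "16 * exp C * exp (- R / 2) \<le> 1" using elim \<delta> by (simp add: \<delta>_def)
        qed (use C0 R in auto)
        then have "?bad j x (x j)" using ij(1) by (auto simp: late_or_deep_def)
        then show ?thesis using False by simp
      qed (use ij in simp)
      show "i \<in> ?B \<or> j \<in> ?B" if "i < n" "j < n" "kpkvb_adj R x i j" for i j
      proof (cases i j rule: linorder_cases)
        case less
        then show ?thesis using cover[of i j] that by blast
      next
        case equal
        then show ?thesis using that by (simp add: kpkvb_adj_def)
      next
        case greater
        then show ?thesis using cover[of j i] that sympD[OF kpkvb_adj_symp] by blast
      qed
    qed (auto simp: kpkvb_adj_def)
    then show ?case using A A' unfolding kpkvb_space_def R_def[symmetric] by (intro bexI[of _ A]) auto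
  qed
qed

subsection \<open>Expected weights of binary trees of cells\<close>

definition hits :: "nat \<Rightarrow> 'a set \<Rightarrow> (nat \<Rightarrow> 'a) \<Rightarrow> nat" where
  "hits n A x = card {i. i < n \<and> x i \<in> A}"

lemma hits_Un_disjoint: "A \<inter> B = {} \<Longrightarrow> hits n (A \<union> B) x = hits n A x + hits n B x"
  unfolding hits_def by (subst card_Un_disjoint[symmetric]) (auto intro!: arg_cong[of _ _ card])

lemma hits_empty [simp]: "hits n {} x = 0"
  by (simp add: hits_def)

lemma exp_minus_hits: "exp (- real (hits n A x)) = (\<Prod>i\<in>{0..<n}. exp (- indicator A (x i)))"
proof -
  have "real (hits n A x) = (\<Sum>i\<in>{0..<n}. indicator A (x i))"
    unfolding hits_def indicator_def by (simp add: sum_of_bool_eq) (auto intro!: arg_cong[of _ _ card])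
  then show ?thesis by (simp add: exp_sum flip: sum_negf)
qed

lemma borel_measurable_exp_minus_hits [measurable]:
  assumes [measurable]: "A \<in> sets M"
  shows "(\<lambda>x. exp (- real (hits n A x))) \<in> borel_measurable (PiM {0..<n} (\<lambda>_. M))"
  unfolding exp_minus_hits by measurable

context prob_space
begin

text \<open>By independence the mean is the \<open>n\<close>-th power of
  \<open>1 - (1 - exp (-1)) * prob A\<close>. As \<open>exp (-1) \<le> 1 / 2\<close>, this base is
  at most \<open>exp (- prob A / 2)\<close>.\<close>

lemma exp_minus_hits_integral:
  fixes n :: nat
  assumes [measurable]: "A \<in> sets M"
  defines "P \<equiv> PiM {0..<n} (\<lambda>_. M)"
  shows "integrable P (\<lambda>x. exp (- real (hits n A x)))"
    and "(\<integral>x. exp (- real (hits n A x)) \<partial>P) \<le> exp (- real n * prob A / 2)"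
proof -
  interpret P: prob_space P unfolding P_def by (intro prob_space_PiM prob_space_axioms)
  interpret S: product_sigma_finite "\<lambda>_::nat. M" ..
  show "integrable P (\<lambda>x. exp (- real (hits n A x)))"
    by (intro P.integrable_const_bound[of _ 1]) (auto simp: P_def)
  have int: "integrable M (\<lambda>p. exp (- indicator A p) :: real)"
    by (intro integrable_const_bound[of _ 1]) auto
  have e1: "exp (-1) \<le> (1/2::real)"
    using exp_ge_add_one_self[of 1] by (simp add: exp_minus field_simps)
  have "exp (- indicator A p) = 1 - (1 - exp (-1)) * (indicator A p :: real)" for p :: 'a
    by (auto simp: indicator_def)
  then have "(\<integral>p. exp (- indicator A p) \<partial>M) = (\<integral>p. 1 - (1 - exp (-1)) * (indicator A p :: real) \<partial>M)"
    by simp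
  also have "\<dots> = 1 - (1 - exp (-1)) * prob A"
    by (subst Bochner_Integration.integral_diff)
      (auto simp: prob_space intro!: integrable_real_indicator simp: emeasure_eq_measure)
  also have "\<dots> \<le> 1 - prob A / 2"
    using mult_right_mono[OF e1, of "prob A"] by (simp add: algebra_simps)
  also have "\<dots> \<le> exp (- (prob A / 2))" using exp_ge_add_one_self[of "- (prob A / 2)"] by simp
  finally have le: "(\<integral>p. exp (- indicator A p) \<partial>M) \<le> exp (- (prob A / 2))" .
  have "(\<integral>x. exp (- real (hits n A x)) \<partial>P) = (\<integral>p. exp (- indicator A p) \<partial>M) ^ n"
    unfolding exp_minus_hits P_def by (subst S.product_integral_prod[OF _ int]) auto
  also have "\<dots> \<le> exp (- (prob A / 2)) ^ n" by (intro power_mono le integral_nonneg_AE) auto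
  also have "\<dots> = exp (- real n * prob A / 2)" by (simp add: exp_of_nat_mult[symmetric])
  finally show "(\<integral>x. exp (- real (hits n A x)) \<partial>P) \<le> exp (- real n * prob A / 2)" .
qed

end

text \<open>A list of pairs \<open>(c, A)\<close> encodes the random variable \<open>\<Sum> c * exp (- hits A)\<close>. Such sums are
  closed under products as long as the sets involved stay disjoint, and then the bounds on their
  expectations multiply, although the numbers of hits are not independent.\<close>
definition exp_hits_sum :: "nat \<Rightarrow> (real \<times> 'a set) list \<Rightarrow> (nat \<Rightarrow> 'a) \<Rightarrow> real" where
  "exp_hits_sum n xs x = (\<Sum>(c, A)\<leftarrow>xs. c * exp (- real (hits n A x)))"

text \<open>Each exponential is replaced by the bound of \<open>exp_minus_hits_integral\<close> on
  its mean.\<close>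

definition exp_hits_bound :: "nat \<Rightarrow> 'a measure \<Rightarrow> (real \<times> 'a set) list \<Rightarrow> real" where
  "exp_hits_bound n M xs = (\<Sum>(c, A)\<leftarrow>xs. c * exp (- real n * measure M A / 2))"

text \<open>\<open>U\<close> confines all sets of the list, so that disjointness of two lists can be
  read off from their confining regions.\<close>

definition exp_hits_in :: "'a measure \<Rightarrow> 'a set \<Rightarrow> (real \<times> 'a set) list \<Rightarrow> bool" where
  "exp_hits_in M U xs \<longleftrightarrow> (\<forall>(c, A)\<in>set xs. 0 \<le> c \<and> A \<in> sets M \<and> A \<subseteq> U)"

lemma exp_hits_bound_nonneg: "exp_hits_in M U xs \<Longrightarrow> 0 \<le> exp_hits_bound n M xs"
  unfolding exp_hits_bound_def exp_hits_in_def by (force intro!: sum_list_nonneg)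

text \<open>Encodes the product of the two sums with the further factor
  \<open>exp (- hits B)\<close>.\<close>

definition exp_hits_times :: "'a set \<Rightarrow> (real \<times> 'a set) list \<Rightarrow> (real \<times> 'a set) list \<Rightarrow> (real \<times> 'a set) list" where
  "exp_hits_times B xs ys = concat (map (\<lambda>(c, A). map (\<lambda>(d, A'). (c * d, A \<union> A' \<union> B)) ys) xs)"

context prob_space
begin

lemma exp_hits_sum_integral:
  fixes n :: nat
  assumes "exp_hits_in M U xs"
  defines "P \<equiv> PiM {0..<n} (\<lambda>_. M)"
  shows "integrable P (exp_hits_sum n xs) \<and> (\<integral>x. exp_hits_sum n xs x \<partial>P) \<le> exp_hits_bound n M xs"
  using assms(1)
proof (induction xs)
  case Nil
  then show ?case by (simp add: exp_hits_sum_def[abs_def] exp_hits_bound_def)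
next
  case (Cons a xs)
  obtain c A where a: "a = (c, A)" by (cases a)
  have cA: "0 \<le> c" "A \<in> sets M" using Cons.prems by (auto simp: exp_hits_in_def a)
  have IH: "integrable P (exp_hits_sum n xs)" "(\<integral>x. exp_hits_sum n xs x \<partial>P) \<le> exp_hits_bound n M xs"
    using Cons by (auto simp: exp_hits_in_def)
  have eq: "exp_hits_sum n ((c, A) # xs) = (\<lambda>x. c * exp (- real (hits n A x)) + exp_hits_sum n xs x)"
    by (simp add: exp_hits_sum_def[abs_def])
  have "c * (\<integral>x. exp (- real (hits n A x)) \<partial>P) \<le> c * exp (- real n * prob A / 2)"
    using exp_minus_hits_integral(2)[OF cA(2)] cA(1) unfolding P_def by (rule mult_left_mono)
  then show ?case
    using IH exp_minus_hits_integral(1)[OF cA(2), of n]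
    unfolding a eq by (simp add: P_def exp_hits_bound_def)
qed

lemma exp_hits_times:
  assumes xs: "exp_hits_in M U xs" and ys: "exp_hits_in M V ys" and B: "B \<in> sets M"
    and disj: "U \<inter> V = {}" "U \<inter> B = {}" "V \<inter> B = {}"
  shows "exp_hits_in M (U \<union> V \<union> B) (exp_hits_times B xs ys)"
    and "exp_hits_sum n (exp_hits_times B xs ys) x
      = exp_hits_sum n xs x * exp_hits_sum n ys x * exp (- real (hits n B x))"
    and "exp_hits_bound n M (exp_hits_times B xs ys)
      = exp_hits_bound n M xs * exp_hits_bound n M ys * exp (- real n * prob B / 2)"
proof -
  show "exp_hits_in M (U \<union> V \<union> B) (exp_hits_times B xs ys)"
    using xs ys B unfolding exp_hits_in_def exp_hits_times_def by fastforce
  \<comment> \<open>Both identities are instances of one for functions \<open>f\<close> that turn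
    disjoint unions into products.\<close>
  have generic: "(\<Sum>(c, A)\<leftarrow>exp_hits_times B xs ys. c * f A)
      = (\<Sum>(c, A)\<leftarrow>xs. c * f A) * (\<Sum>(c, A)\<leftarrow>ys. c * f A) * f B"
    if f: "\<And>A A'. A \<in> sets M \<Longrightarrow> A' \<in> sets M \<Longrightarrow> A \<inter> A' = {} \<Longrightarrow> f (A \<union> A') = f A * f A'" for f :: "'a set \<Rightarrow> real"
    using xs
  proof (induction xs)
    case Nil
    then show ?case by (simp add: exp_hits_times_def)
  next
    case (Cons a xs)
    obtain c A where a: "a = (c, A)" by (cases a)
    have A: "A \<in> sets M" "A \<subseteq> U" using Cons.prems by (auto simp: exp_hits_in_def a)
    have IH: "(\<Sum>(c, A)\<leftarrow>exp_hits_times B xs ys. c * f A)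
      = (\<Sum>(c, A)\<leftarrow>xs. c * f A) * (\<Sum>(c, A)\<leftarrow>ys. c * f A) * f B"
      using Cons by (auto simp: exp_hits_in_def)
    have "(\<Sum>(d, A')\<leftarrow>ys. c * d * f (A \<union> A' \<union> B)) = c * f A * (\<Sum>(d, A')\<leftarrow>ys. d * f A') * f B"
      using ys
    proof (induction ys)
      case (Cons b ys)
      obtain d A' where b: "b = (d, A')" by (cases b)
      have A': "A' \<in> sets M" "A' \<subseteq> V" using Cons.prems by (auto simp: exp_hits_in_def b)
      have "f (A \<union> A' \<union> B) = f (A \<union> A') * f B"
        using A A' B disj by (intro f) auto
      also have "f (A \<union> A') = f A * f A'" using A A' disj by (intro f) auto
      finally have "f (A \<union> A' \<union> B) = f A * f A' * f B" .
      then show ?case using Cons by (simp add: b exp_hits_in_def algebra_simps)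
    qed simp
    then have "(\<Sum>(c, A)\<leftarrow>map (\<lambda>(d, A'). (c * d, A \<union> A' \<union> B)) ys. c * f A)
       = c * f A * (\<Sum>(d, A')\<leftarrow>ys. d * f A') * f B"
      by (simp add: o_def case_prod_unfold)
    then show ?case using IH by (simp add: exp_hits_times_def a algebra_simps)
  qed
  show "exp_hits_sum n (exp_hits_times B xs ys) x
      = exp_hits_sum n xs x * exp_hits_sum n ys x * exp (- real (hits n B x))"
    unfolding exp_hits_sum_def
    by (rule generic) (simp add: hits_Un_disjoint exp_add[symmetric])
  show "exp_hits_bound n M (exp_hits_times B xs ys)
      = exp_hits_bound n M xs * exp_hits_bound n M ys * exp (- real n * prob B / 2)"
    unfolding exp_hits_bound_def
    by (rule generic) (simp add: finite_measure_Union exp_add[symmetric] distrib_left add_divide_distrib)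
qed

end

text \<open>\<open>tree_weight n B l j\<close> belongs to the \<open>j\<close>-th node of level \<open>l\<close> of a binary forest, where
  the children of node \<open>j\<close> are \<open>2 * j\<close> and \<open>2 * j + 1\<close>; it dominates \<open>exp k\<close> for the number \<open>k\<close> of paths
  needed to cover the points below that node.\<close>
fun tree_weight :: "nat \<Rightarrow> (nat \<Rightarrow> nat \<Rightarrow> 'a set) \<Rightarrow> nat \<Rightarrow> nat \<Rightarrow> (nat \<Rightarrow> 'a) \<Rightarrow> real" where
  "tree_weight n B 0 j x = exp 1"
| "tree_weight n B (Suc l) j x = exp 1 +
     tree_weight n B l (2 * j) x * tree_weight n B l (2 * j + 1) x * exp (- real (hits n (B (Suc l) j) x))"

lemma tree_weight_pos: "0 < tree_weight n B l j x"
  by (induction l arbitrary: j) (auto intro!: add_pos_pos mult_pos_pos)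

context prob_space
begin

text \<open>\<open>U l j\<close> is the region of the whole subtree of a node. The bound
  \<open>2 * exp 1\<close> is preserved by induction: six expected hits contribute
  \<open>exp (- 3)\<close>, and \<open>exp 1 + (2 * exp 1) * (2 * exp 1) * exp (- 3) \<le> 2 * exp
  1\<close> because the square of \<open>exp 1\<close> is at least 4.\<close>

lemma tree_weight_expansion:
  fixes B U :: "nat \<Rightarrow> nat \<Rightarrow> 'a set"
  assumes B: "\<And>l j. B l j \<in> sets M"
    and U: "\<And>l j. U l (2 * j) \<union> U l (2 * j + 1) \<union> B (Suc l) j \<subseteq> U (Suc l) j"
    and disj: "\<And>l j. U l (2 * j) \<inter> U l (2 * j + 1) = {}"
      "\<And>l j. U l j \<inter> B (Suc l) (j div 2) = {}"
    and large: "\<And>l j. 0 < l \<Longrightarrow> l \<le> T \<Longrightarrow> j < D * 2 ^ (T - l) \<Longrightarrow> 6 \<le> real n * prob (B l j)"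
    and l: "l \<le> T" "j < D * 2 ^ (T - l)"
  shows "\<exists>xs. exp_hits_in M (U l j) xs \<and> exp_hits_sum n xs = tree_weight n B l j \<and>
    exp_hits_bound n M xs \<le> 2 * exp 1"
  using l
proof (induction l arbitrary: j)
  case 0
  then show ?case
    by (intro exI[of _ "[(exp 1, {})]"])
      (auto simp: exp_hits_in_def exp_hits_sum_def[abs_def] exp_hits_bound_def)
next
  case (Suc l)
  have "2 * j + 1 < D * 2 ^ (T - l)"
  proof -
    have "T - l = Suc (T - Suc l)" using Suc.prems by simp
    then have "D * 2 ^ (T - l) = 2 * (D * 2 ^ (T - Suc l))" by simp
    then show ?thesis using Suc.prems by linarith
  qed
  then obtain xs ys where xs: "exp_hits_in M (U l (2 * j)) xs" "exp_hits_sum n xs = tree_weight n B l (2 * j)"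
     "exp_hits_bound n M xs \<le> 2 * exp 1"
    and ys: "exp_hits_in M (U l (2 * j + 1)) ys" "exp_hits_sum n ys = tree_weight n B l (2 * j + 1)"
     "exp_hits_bound n M ys \<le> 2 * exp 1"
    using Suc.IH[of "2 * j"] Suc.IH[of "2 * j + 1"] Suc.prems by auto
  let ?B = "B (Suc l) j"
  define zs where "zs = (exp 1, {}) # exp_hits_times ?B xs ys"
  have dj: "U l (2 * j) \<inter> U l (2 * j + 1) = {}" "U l (2 * j) \<inter> ?B = {}" "U l (2 * j + 1) \<inter> ?B = {}"
    using disj(1)[of l j] disj(2)[of l "2 * j"] disj(2)[of l "2 * j + 1"] Suc.prems by auto
  note T = exp_hits_times[OF xs(1) ys(1) B dj]
  have "exp_hits_in M (U (Suc l) j) zs"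
    using T(1) U[of l j] unfolding zs_def exp_hits_in_def by fastforce
  moreover have "exp_hits_sum n zs = tree_weight n B (Suc l) j"
  proof
    fix x
    have "exp_hits_sum n zs x = exp 1 + exp_hits_sum n (exp_hits_times ?B xs ys) x"
      by (simp add: zs_def exp_hits_sum_def)
    then show "exp_hits_sum n zs x = tree_weight n B (Suc l) j x" by (simp add: T(2) xs(2) ys(2))
  qed
  moreover have "exp_hits_bound n M zs \<le> 2 * exp 1"
  proof -
    have nn: "0 \<le> exp_hits_bound n M xs" "0 \<le> exp_hits_bound n M ys"
      using exp_hits_bound_nonneg xs(1) ys(1) by blast+
    have "exp_hits_bound n M zs = exp 1 + exp_hits_bound n M (exp_hits_times ?B xs ys)"
      by (simp add: zs_def exp_hits_bound_def)
    also have "\<dots> = exp 1 + exp_hits_bound n M xs * exp_hits_bound n M ys * exp (- real n * prob ?B / 2)"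
      by (simp only: T(3))
    also have "\<dots> \<le> exp 1 + (2 * exp 1) * (2 * exp 1) * exp (- 3)"
    proof (intro add_left_mono mult_mono)
      have "6 \<le> real n * prob ?B" using large[of "Suc l" j] Suc.prems by simp
      then show "exp (- real n * prob ?B / 2) \<le> exp (- 3)" by simp
    qed (use xs ys nn in auto)
    also have "(2 * exp 1) * (2 * exp 1) * exp (- 3) = 4 * exp (-1 :: real)"
      by (simp flip: exp_add)
    also have "\<dots> \<le> exp 1"
    proof -
      have "(2::real) * 2 \<le> exp 1 * exp 1" using exp_ge_add_one_self[of 1] by (intro mult_mono) auto
      then show ?thesis by (simp add: exp_minus field_simps)
    qed
    finally show ?thesis by simp
  qed
  ultimately show ?case by blast
qed

text \<open>The top level omits the summand \<open>exp 1\<close>: \<open>W x < exp (- 2)\<close>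
  will mean that the top cell has at least two more points than there are paths. Markov's inequality
  gives the constant \<open>(2 * exp 1) * (2 * exp 1) / exp (- 2) = 4 * exp 4\<close>. Each of the
  \<open>D\<close> top nodes has two children at level \<open>t\<close>, hence
  \<open>2 * D\<close>.\<close>

lemma tree_weight_top_prob:
  fixes B U :: "nat \<Rightarrow> nat \<Rightarrow> 'a set"
  assumes B: "\<And>l j. B l j \<in> sets M"
    and U: "\<And>l j. U l (2 * j) \<union> U l (2 * j + 1) \<union> B (Suc l) j \<subseteq> U (Suc l) j"
    and disj: "\<And>l j. U l (2 * j) \<inter> U l (2 * j + 1) = {}"
      "\<And>l j. U l j \<inter> B (Suc l) (j div 2) = {}"
    and large: "\<And>l j. 0 < l \<Longrightarrow> l \<le> t \<Longrightarrow> j < 2 * D * 2 ^ (t - l) \<Longrightarrow> 6 \<le> real n * prob (B l j)"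
    and j: "j < D"
  defines "W \<equiv> \<lambda>x. tree_weight n B t (2 * j) x * tree_weight n B t (2 * j + 1) x * exp (- real (hits n (B (Suc t) j) x))"
    and "P \<equiv> PiM {0..<n} (\<lambda>_. M)"
  shows "W \<in> borel_measurable P"
    and "measure P {x \<in> space P. exp (- 2) \<le> W x} \<le> 4 * exp 4 * exp (- real n * prob (B (Suc t) j) / 2)"
proof -
  interpret P: prob_space P unfolding P_def by (intro prob_space_PiM prob_space_axioms)
  note E = tree_weight_expansion[where B = B and U = U and T = t and D = "2 * D" and n = n, OF B U disj large]
  obtain xs ys where xs: "exp_hits_in M (U t (2 * j)) xs" "exp_hits_sum n xs = tree_weight n B t (2 * j)"
     "exp_hits_bound n M xs \<le> 2 * exp 1"
    and ys: "exp_hits_in M (U t (2 * j + 1)) ys" "exp_hits_sum n ys = tree_weight n B t (2 * j + 1)"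
     "exp_hits_bound n M ys \<le> 2 * exp 1"
    using E[of t "2 * j"] E[of t "2 * j + 1"] j by auto
  let ?B = "B (Suc t) j"
  have dj: "U t (2 * j) \<inter> U t (2 * j + 1) = {}" "U t (2 * j) \<inter> ?B = {}" "U t (2 * j + 1) \<inter> ?B = {}"
    using disj(1)[of t j] disj(2)[of t "2 * j"] disj(2)[of t "2 * j + 1"] by auto
  note T = exp_hits_times[OF xs(1) ys(1) B dj]
  have W: "W = exp_hits_sum n (exp_hits_times ?B xs ys)"
    by (rule ext) (simp add: W_def T(2) xs(2) ys(2))
  have int: "integrable P W" "(\<integral>x. W x \<partial>P) \<le> exp_hits_bound n M (exp_hits_times ?B xs ys)"
    using exp_hits_sum_integral[OF T(1), of n] by (auto simp: W P_def)
  then show "W \<in> borel_measurable P" by auto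
  have nn: "0 \<le> exp_hits_bound n M xs" "0 \<le> exp_hits_bound n M ys"
    using exp_hits_bound_nonneg xs(1) ys(1) by blast+
  have "measure P {x \<in> space P. exp (- 2) \<le> W x} \<le> (\<integral>x. W x \<partial>P) / exp (- 2)"
    using int tree_weight_pos[of n B t]
    by (intro integral_Markov_inequality_measure[of _ _ "{}"]) (auto simp: W_def intro!: AE_I2 mult_nonneg_nonneg less_imp_le)
  also have "\<dots> \<le> exp_hits_bound n M xs * exp_hits_bound n M ys * exp (- real n * prob ?B / 2) / exp (- 2)"
    using int(2) unfolding T(3) by (intro divide_right_mono) auto
  also have "\<dots> \<le> (2 * exp 1) * (2 * exp 1) * exp (- real n * prob ?B / 2) / exp (- 2)"
    using xs ys nn by (intro divide_right_mono mult_right_mono mult_mono) auto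
  also have "\<dots> = 4 * exp 4 * exp (- real n * prob ?B / 2)"
    by (simp add: exp_minus field_simps flip: exp_add)
  finally show "measure P {x \<in> space P. exp (- 2) \<le> W x} \<le> 4 * exp 4 * exp (- real n * prob (B (Suc t) j) / 2)" .
qed

end

subsection \<open>Large intensity\<close>

definition level_arc :: "real \<Rightarrow> nat \<Rightarrow> nat \<Rightarrow> real set" where
  "level_arc w l j = {w * 2 ^ l * real j<..w * 2 ^ l * (real j + 1)}"

text \<open>The value \<open>0\<close> beyond level \<open>T\<close> makes the cells of level \<open>T\<close> reach down to the origin.\<close>
definition level_radius :: "real \<Rightarrow> nat \<Rightarrow> nat \<Rightarrow> real" where
  "level_radius R T l = (if l \<le> T then R - 2 * real l * ln 2 else 0)"

definition cell :: "real \<Rightarrow> nat \<Rightarrow> real \<Rightarrow> nat \<Rightarrow> nat \<Rightarrow> (real \<times> real) set" where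
  "cell R T w l j = {level_radius R T (Suc l)..<level_radius R T l} \<times> level_arc w l j"

text \<open>The union of a cell and of all cells of lower level between it and the boundary.\<close>

definition sector :: "real \<Rightarrow> nat \<Rightarrow> real \<Rightarrow> nat \<Rightarrow> nat \<Rightarrow> (real \<times> real) set" where
  "sector R T w l j = {level_radius R T (Suc l)..<R} \<times> level_arc w l j"

lemma level_arc_Suc: "0 < w \<Longrightarrow> level_arc w (Suc l) j = level_arc w l (2 * j) \<union> level_arc w l (2 * j + 1)"
proof -
  assume "0 < w"
  then have c: "0 \<le> w * 2 ^ l" by simp
  have "level_arc w (Suc l) j = {w * 2 ^ l * (2 * real j)<..w * 2 ^ l * (2 * real j + 2)}"
    by (simp add: level_arc_def algebra_simps)
  also have "\<dots> = {w * 2 ^ l * (2 * real j)<..w * 2 ^ l * (2 * real j + 1)} \<union>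
      {w * 2 ^ l * (2 * real j + 1)<..w * 2 ^ l * (2 * real j + 2)}"
    using c by (intro ivl_disj_un_two(6)[symmetric] mult_left_mono) auto
  also have "\<dots> = level_arc w l (2 * j) \<union> level_arc w l (2 * j + 1)"
    by (simp add: level_arc_def add.commute)
  finally show ?thesis .
qed

lemma level_arc_disjoint:
  assumes "0 < w" "i < j"
  shows "level_arc w l i \<inter> level_arc w l j = {}"
proof -
  have "w * 2 ^ l * (real i + 1) \<le> w * 2 ^ l * real j" using assms by (intro mult_left_mono) auto
  then show ?thesis by (auto simp: level_arc_def)
qed

lemma level_arc_UN:
  assumes "0 < w"
  shows "(\<Union>j<D. level_arc w l j) = {0<..w * 2 ^ l * real D}"
proof (induction D)
  case (Suc D)
  have "(\<Union>j<Suc D. level_arc w l j) = {0<..w * 2 ^ l * real D} \<union> {w * 2 ^ l * real D<..w * 2 ^ l * (real D + 1)}"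
    using Suc by (auto simp: lessThan_Suc level_arc_def)
  also have "\<dots> = {0<..w * 2 ^ l * (real D + 1)}"
    using assms by (intro ivl_disj_un_two(6) mult_left_mono) auto
  finally show ?case by (simp add: add.commute)
qed simp

lemma level_radius_0 [simp]: "level_radius R T 0 = R"
  by (simp add: level_radius_def)

lemma level_radius_bounds:
  assumes "2 * real T * ln 2 \<le> R"
  shows "0 \<le> level_radius R T l" "level_radius R T l \<le> R"
proof -
  have "2 * real l * ln 2 \<le> 2 * real T * ln 2" if "l \<le> T"
    using that by (intro mult_right_mono) auto
  moreover have "0 \<le> 2 * real T * ln 2" "0 \<le> 2 * real l * ln 2" by simp_all
  ultimately show "0 \<le> level_radius R T l" "level_radius R T l \<le> R"
    unfolding level_radius_def using assms by (cases "l \<le> T"; simp; linarith)+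
qed

lemma level_radius_mono:
  assumes "2 * real T * ln 2 \<le> R" "k \<le> l"
  shows "level_radius R T l \<le> level_radius R T k"
proof (cases "l \<le> T")
  case True
  have "2 * real k * ln 2 \<le> 2 * real l * ln 2" using assms by (intro mult_right_mono) auto
  then show ?thesis using True assms by (simp add: level_radius_def)
next
  case False
  then show ?thesis using level_radius_bounds(1)[OF assms(1), of k] by (simp add: level_radius_def)
qed

lemma sector_Suc:
  assumes "2 * real T * ln 2 \<le> R" "0 < w"
  shows "sector R T w (Suc l) j = sector R T w l (2 * j) \<union> sector R T w l (2 * j + 1) \<union> cell R T w (Suc l) j"
  using level_radius_mono[OF assms(1), of "Suc l" "Suc (Suc l)"] level_radius_bounds[OF assms(1), of "Suc l"]
  unfolding sector_def cell_def level_arc_Suc[OF assms(2), of l j] by auto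

lemma sector_disjoint:
  assumes "0 < w" "i < j"
  shows "sector R T w l i \<inter> sector R T w l j = {}"
  using level_arc_disjoint[OF assms] by (auto simp: sector_def)

lemma sector_cell_disjoint: "sector R T w l j \<inter> cell R T w (Suc l) j' = {}"
  by (auto simp: sector_def cell_def)

text \<open>The point \<open>p\<close> is at distance at least \<open>2 * l * ln 2\<close> from the
  boundary, which enlarges the admissible squared angle by \<open>4 ^ l\<close>. The squared width
  of the arc grows by the same factor, so the condition on \<open>w\<close> serves all
  levels.\<close>

lemma cell_adjacent:
  assumes R: "2 * real T * ln 2 \<le> R" and w: "0 < w" "w\<^sup>2 \<le> exp (- R) / 2" and l: "l \<le> T"
    and p: "p \<in> {0..<level_radius R T l} \<times> level_arc w l j" and q: "q \<in> {0..<R} \<times> level_arc w l j"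
  shows "hyp_dist p q \<le> R"
proof -
  obtain r1 t1 r2 t2 where pq: "p = (r1, t1)" "q = (r2, t2)" by (cases p; cases q)
  let ?y = "2 * real l * ln 2"
  have "?y \<le> 2 * real T * ln 2" using l by (intro mult_right_mono) auto
  then have y: "0 \<le> ?y" "?y \<le> R" using R by (simp, linarith)
  have "\<bar>t1 - t2\<bar> \<le> w * 2 ^ l"
    using p q w by (auto simp: pq level_arc_def algebra_simps abs_le_iff)
  then have "(t1 - t2)\<^sup>2 \<le> (w * 2 ^ l)\<^sup>2" by (simp add: abs_le_square_iff[symmetric] w(1) less_imp_le)
  also have "\<dots> = w\<^sup>2 * 4 ^ l" 
  proof -
    have "(2 ^ l)\<^sup>2 = (4 :: real) ^ l" by (simp add: power2_eq_square flip: power_mult_distrib)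
    then show ?thesis by (simp only: power_mult_distrib)
  qed
  also have "\<dots> \<le> exp (- R) / 2 * 4 ^ l" using w by (intro mult_right_mono) auto
  also have "4 ^ l = exp ?y"
  proof -
    have "exp ?y = exp (real l * ln 4)" using ln_realpow[of 2 2] by simp
    also have "\<dots> = 4 ^ l" by (simp add: exp_of_nat_mult)
    finally show ?thesis by simp
  qed
  also have "exp (- R) / 2 * exp ?y = exp (?y - R) / 2" by (simp add: exp_diff exp_minus field_simps)
  finally have "(t1 - t2)\<^sup>2 \<le> exp (?y - R) / 2" .
  then show ?thesis unfolding pq using p q y l
    by (intro hyp_dist_le_if_angle_small[where y = ?y]) (auto simp: pq level_radius_def)
qed

section \<open>From tree weights to path covers and a Hamilton cycle\<close>

definition points_in :: "nat \<Rightarrow> (nat \<Rightarrow> 'a) \<Rightarrow> 'a set \<Rightarrow> nat set" where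
  "points_in n x A = {i. i < n \<and> x i \<in> A}"

lemma points_in_Un: "points_in n x (A \<union> B) = points_in n x A \<union> points_in n x B"
  by (auto simp: points_in_def)

lemma points_in_disjoint: "A \<inter> B = {} \<Longrightarrow> points_in n x A \<inter> points_in n x B = {}"
  by (auto simp: points_in_def)

lemma finite_points_in [simp]: "finite (points_in n x A)"
  by (simp add: points_in_def)

lemma hits_eq_card_points_in: "hits n A x = card (points_in n x A)"
  by (simp add: hits_def points_in_def)

text \<open>The two summands match the two arguments of \<open>max\<close>; this is the reason for
  the recursion of \<open>tree_weight\<close>.\<close>

lemma exp_of_merged_cover:
  assumes "k \<le> max 1 (a + b - m)" "exp (real a) \<le> U" "exp (real b) \<le> V"
  shows "exp (real k) \<le> exp 1 + U * V * exp (- real m)"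
proof -
  have p: "0 < U" "0 < V" using assms(2,3) less_le_trans[OF exp_gt_zero] by blast+
  consider "k \<le> 1" | "real k \<le> real a + real b - real m" using assms(1) by linarith
  then show ?thesis
  proof cases
    case 1
    then have "exp (real k) \<le> exp 1" by simp
    then show ?thesis using p by (simp add: add_increasing2)
  next
    case 2
    then have "exp (real k) \<le> exp (real a + real b - real m)" by simp
    also have "\<dots> = exp (real a) * exp (real b) * exp (- real m)" by (simp add: exp_add exp_diff exp_minus field_simps)
    also have "\<dots> \<le> U * V * exp (- real m)" using assms p by (intro mult_right_mono mult_mono) auto
    finally show ?thesis by (simp add: add_increasing)
  qed
qed

text \<open>At level 0 a sector is a clique. Above, the covers of the two halves are joined and the
  points of the cell on top, adjacent to the whole sector, merge the paths.\<close>

lemma sector_path_cover: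
  assumes R: "2 * real T * ln 2 \<le> R" and w: "0 < w" "w\<^sup>2 \<le> exp (- R) / 2" and l: "l \<le> T"
    and E: "symp E" "\<And>i j. i < n \<Longrightarrow> j < n \<Longrightarrow> i \<noteq> j \<Longrightarrow> hyp_dist (x i) (x j) \<le> R \<Longrightarrow> E i j"
  shows "\<exists>ps. path_cover E ps (points_in n x (sector R T w l j)) \<and>
    exp (real (length ps)) \<le> tree_weight n (cell R T w) l j x"
  using l
proof (induction l arbitrary: j)
  case 0
  have "\<exists>ps. path_cover E ps (points_in n x (sector R T w 0 j)) \<and> length ps \<le> 1"
  proof (rule path_cover_clique)
    fix u v assume uv: "u \<in> points_in n x (sector R T w 0 j)" "v \<in> points_in n x (sector R T w 0 j)" "u \<noteq> v"
    have "sector R T w 0 j \<subseteq> {0..<R} \<times> level_arc w 0 j"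
      using level_radius_bounds[OF R, of 1] by (auto simp: sector_def)
    then have "x u \<in> {0..<level_radius R T 0} \<times> level_arc w 0 j" "x v \<in> {0..<R} \<times> level_arc w 0 j"
      using uv by (auto simp: points_in_def)
    from cell_adjacent[OF R w _ this] show "E u v" using uv E(2) by (auto simp: points_in_def)
  qed simp
  then obtain ps where "path_cover E ps (points_in n x (sector R T w 0 j))" "length ps \<le> 1" by blast
  then show ?case by (intro exI[of _ ps]) simp
next
  case (Suc l)
  obtain ps1 where ps1: "path_cover E ps1 (points_in n x (sector R T w l (2 * j)))"
      "exp (real (length ps1)) \<le> tree_weight n (cell R T w) l (2 * j) x" using Suc by force
  obtain ps2 where ps2: "path_cover E ps2 (points_in n x (sector R T w l (2 * j + 1)))"
      "exp (real (length ps2)) \<le> tree_weight n (cell R T w) l (2 * j + 1) x" using Suc by force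
  let ?S = "points_in n x (sector R T w l (2 * j)) \<union> points_in n x (sector R T w l (2 * j + 1))"
  have cover: "path_cover E (ps1 @ ps2) ?S"
    using ps1(1) ps2(1) sector_disjoint[OF w(1)] by (intro path_cover_append points_in_disjoint) auto
  obtain vs where vs: "set vs = points_in n x (cell R T w (Suc l) j)" "distinct vs"
    using finite_distinct_list[OF finite_points_in] by blast
  have lvs: "length vs = hits n (cell R T w (Suc l) j) x"
    using vs distinct_card[of vs] by (simp add: hits_eq_card_points_in)
  have S: "points_in n x (sector R T w (Suc l) j) = ?S \<union> set vs"
    unfolding sector_Suc[OF R w(1)] points_in_Un vs(1) ..
  have "\<exists>qs. path_cover E qs (?S \<union> set vs) \<and> length qs \<le> max 1 (length (ps1 @ ps2) - length vs)"
  proof (rule path_cover_absorb[OF E(1) cover vs(2)])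
    show "?S \<inter> set vs = {}"
      unfolding vs(1) points_in_Un[symmetric] using sector_cell_disjoint by (intro points_in_disjoint) blast
    fix u v assume uv: "u \<in> ?S \<union> set vs" "v \<in> set vs" "u \<noteq> v"
    have "u \<in> points_in n x (sector R T w (Suc l) j)" using uv S by simp
    then have u: "u < n" "x u \<in> {0..<R} \<times> level_arc w (Suc l) j"
      using level_radius_bounds[OF R, of "Suc (Suc l)"] by (auto simp: points_in_def sector_def)
    have v: "v < n" "x v \<in> {0..<level_radius R T (Suc l)} \<times> level_arc w (Suc l) j"
      using uv(2) level_radius_bounds[OF R, of "Suc (Suc l)"] by (auto simp: vs(1) points_in_def cell_def)
    have "hyp_dist (x v) (x u) \<le> R" using cell_adjacent[OF R w Suc.prems v(2) u(2)] .
    then show "E u v" using E(2)[of v u] u v uv sympD[OF E(1)] by blast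
  qed
  then obtain qs where qs: "path_cover E qs (?S \<union> set vs)" "length qs \<le> max 1 (length (ps1 @ ps2) - length vs)" by blast
  have "exp (real (length qs)) \<le> tree_weight n (cell R T w) (Suc l) j x"
    using exp_of_merged_cover[OF _ ps1(2) ps2(2), of "length qs" "length vs"] qs(2) lvs by simp
  then show ?case using qs(1) S by (intro exI[of _ qs]) simp
qed

text \<open>The bounds on \<open>R\<close> place the top radius between \<open>0\<close> and
  \<open>R / 2\<close>. The \<open>D\<close> top sectors tile the disk; each is spanned by one path
  with ends in its top cell, and all top cells lie in the clique \<open>H\<close>.\<close>

lemma has_hamilton_cycle_if_tree_weights_small:
  assumes R: "2 * real (Suc t) * ln 2 \<le> R" "R \<le> 4 * real (Suc t) * ln 2"
    and w: "0 < w" "w\<^sup>2 \<le> exp (- R) / 2" "w * 2 ^ Suc t * real D = 2 * pi" and D: "0 < D"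
    and n: "3 \<le> n" and disk: "\<And>i. i < n \<Longrightarrow> x i \<in> disk_R R"
    and small: "\<And>j. j < D \<Longrightarrow> tree_weight n (cell R (Suc t) w) t (2 * j) x * tree_weight n (cell R (Suc t) w) t (2 * j + 1) x
       * exp (- real (hits n (cell R (Suc t) w (Suc t) j) x)) < exp (- 2)"
    and E: "symp E" "\<And>i j. i < n \<Longrightarrow> j < n \<Longrightarrow> i \<noteq> j \<Longrightarrow> hyp_dist (x i) (x j) \<le> R \<Longrightarrow> E i j"
  shows "has_hamilton_cycle n E"
proof -
  define T where "T = Suc t"
  define S where "S j = points_in n x (sector R T w T j)" for j
  define H where "H = points_in n x ({0..<level_radius R T T} \<times> UNIV)"
  have RT: "2 * real T * ln 2 \<le> R" using R by (simp add: T_def)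
  have sectorT: "sector R T w T j = {0..<R} \<times> level_arc w T j" for j
    by (simp add: sector_def level_radius_def)
  have "\<exists>q. q \<noteq> [] \<and> successively E q \<and> distinct q \<and> set q = S j \<and> hd q \<in> H \<and> last q \<in> H" if "j < D" for j
  proof -
    have tT: "t \<le> T" by (simp add: T_def)
    obtain ps1 where ps1: "path_cover E ps1 (points_in n x (sector R T w t (2 * j)))"
      "exp (real (length ps1)) \<le> tree_weight n (cell R T w) t (2 * j) x"
      using sector_path_cover[OF RT w(1,2) tT E] by blast
    obtain ps2 where ps2: "path_cover E ps2 (points_in n x (sector R T w t (2 * j + 1)))"
      "exp (real (length ps2)) \<le> tree_weight n (cell R T w) t (2 * j + 1) x"
      using sector_path_cover[OF RT w(1,2) tT E] by blast
    let ?S = "points_in n x (sector R T w t (2 * j)) \<union> points_in n x (sector R T w t (2 * j + 1))"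
    have cover: "path_cover E (ps1 @ ps2) ?S"
      using ps1(1) ps2(1) sector_disjoint[OF w(1)] by (intro path_cover_append points_in_disjoint) auto
    obtain vs where vs: "set vs = points_in n x (cell R T w T j)" "distinct vs"
      using finite_distinct_list[OF finite_points_in] by blast
    have lvs: "length vs = hits n (cell R T w T j) x"
      using vs distinct_card[of vs] by (simp add: hits_eq_card_points_in)
    have S: "S j = ?S \<union> set vs"
      unfolding S_def vs(1) unfolding T_def
      unfolding sector_Suc[OF RT[unfolded T_def] w(1)] points_in_Un ..
    have "exp (real (length ps1)) * exp (real (length ps2)) * exp (- real (length vs))
       \<le> tree_weight n (cell R T w) t (2 * j) x * tree_weight n (cell R T w) t (2 * j + 1) x * exp (- real (length vs))"
      using ps1(2) ps2(2) by (intro mult_right_mono mult_mono) (auto intro: less_imp_le[OF tree_weight_pos])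
    also have "\<dots> < exp (- 2)" using small[OF that] by (simp add: lvs T_def)
    finally have "exp (real (length ps1) + real (length ps2) - real (length vs)) < exp (- 2)"
      by (simp add: exp_add exp_diff exp_minus field_simps)
    \<comment> \<open>The exponent is below \<open>- 2\<close>, which leaves two points of the top
      cell for the ends of the path.\<close>
    then have len: "length (ps1 @ ps2) + 2 \<le> length vs" by simp
    have "\<exists>q. q \<noteq> [] \<and> successively E q \<and> distinct q \<and> set q = ?S \<union> set vs \<and> hd q \<in> set vs \<and> last q \<in> set vs"
    proof (rule hamilton_path_with_hub_ends[OF E(1) cover vs(2)])
      show "?S \<inter> set vs = {}"
        unfolding vs(1) points_in_Un[symmetric] T_def using sector_cell_disjoint
        by (intro points_in_disjoint) blast
      fix u v assume uv: "u \<in> ?S \<union> set vs" "v \<in> set vs" "u \<noteq> v"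
      have "u \<in> points_in n x (sector R T w T j)" using uv(1) S by (simp add: S_def)
      then have u: "u < n" "x u \<in> {0..<R} \<times> level_arc w T j" by (auto simp: points_in_def sectorT)
      have v: "v < n" "x v \<in> {0..<level_radius R T T} \<times> level_arc w T j"
        using uv(2) level_radius_bounds[OF RT, of "Suc T"] by (auto simp: vs(1) points_in_def cell_def)
      have "hyp_dist (x v) (x u) \<le> R" using cell_adjacent[OF RT w(1,2) order.refl v(2) u(2)] .
      then show "E u v" using E(2)[of v u] u v uv sympD[OF E(1)] by blast
    qed (rule len)
    moreover have "set vs \<subseteq> H"
      using level_radius_bounds[OF RT, of "Suc T"] by (auto simp: vs(1) H_def points_in_def cell_def)
    ultimately show ?thesis unfolding S by blast
  qed
  then obtain q where q: "\<And>j. j < D \<Longrightarrow> q j \<noteq> [] \<and> successively E (q j) \<and> distinct (q j) \<and> set (q j) = S j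
     \<and> hd (q j) \<in> H \<and> last (q j) \<in> H" by metis
  show ?thesis
  proof (rule has_hamilton_cycle_concat[OF n D q])
    show "S i \<inter> S j = {}" if "i < j" for i j
      unfolding S_def using sector_disjoint[OF w(1) that] by (intro points_in_disjoint)
    have "(\<Union>j<D. S j) = points_in n x ({0..<R} \<times> (\<Union>j<D. level_arc w T j))"
      by (auto simp: S_def points_in_def sectorT)
    also have "(\<Union>j<D. level_arc w T j) = {0<..2 * pi}"
      using w by (subst level_arc_UN) (auto simp: T_def)
    also have "points_in n x ({0..<R} \<times> {0<..2 * pi}) = {0..<n}"
      using disk by (auto simp: points_in_def disk_R_def)
    finally show "(\<Union>j<D. S j) = {0..<n}" .
    fix u v assume uv: "u \<in> H" "v \<in> H" "u \<noteq> v"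
    \<comment> \<open>Radii in \<open>H\<close> are below \<open>R / 2\<close>, so any two of them
      add up to at most \<open>R\<close>.\<close>
    have "2 * level_radius R T T = 2 * R - 4 * real T * ln 2" by (simp add: level_radius_def)
    then have "2 * level_radius R T T \<le> R" using R(2) unfolding T_def by linarith
    then have "hyp_dist (fst (x u), snd (x u)) (fst (x v), snd (x v)) \<le> R"
      using uv by (intro hyp_dist_le_if_radii_small) (auto simp: H_def points_in_def)
    then show "E u v" using uv E(2)[of u v] by (simp add: H_def points_in_def)
  qed
qed

section \<open>Lower bounds for the mass of a cell\<close>

lemma radial_mass_ge:
  fixes \<alpha> :: real
  assumes \<alpha>: "0 < \<alpha>" and h: "h = \<alpha> * ln 2" and R: "0 < R" and b: "0 \<le> b" "b \<le> a - 2 * ln 2"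
    and a: "a \<le> R"
  shows "2 * exp (- h) * (1 - exp (- 2 * h)) * sinh h * exp (\<alpha> * (a - R))
    \<le> (cosh (\<alpha> * a) - cosh (\<alpha> * b)) / (cosh (\<alpha> * R) - 1)"
proof -
  have h0: "0 < h" using \<alpha> h by simp
  define A where "A = \<alpha> * a"
  have A: "\<alpha> * b \<le> A - 2 * h" "0 \<le> A - 2 * h"
  proof -
    have "\<alpha> * b \<le> \<alpha> * (a - 2 * ln 2)" using \<alpha> b by (intro mult_left_mono) auto
    then show "\<alpha> * b \<le> A - 2 * h" by (simp add: A_def h algebra_simps)
    moreover have "0 \<le> \<alpha> * b" using \<alpha> b by simp
    ultimately show "0 \<le> A - 2 * h" by linarith
  qed
  have c1: "1 < cosh (\<alpha> * R)"
    using \<alpha> R cosh_real_nonneg_less_iff[of 0 "\<alpha> * R"] by simp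
  \<comment> \<open>The numerator is at least
    \<open>cosh A - cosh (A - 2 * h) = 2 * sinh (A - h) * sinh h\<close>, where \<open>2 * h\<close>
    is \<open>\<alpha>\<close> times the thickness \<open>2 * ln 2\<close>. As
    \<open>2 * h \<le> A\<close>, the factor \<open>2 * sinh (A - h)\<close> is comparable to
    \<open>exp (A - h)\<close>.\<close>
  have "exp (A - h) * (1 - exp (- 2 * h)) \<le> 2 * sinh (A - h)"
  proof -
    have "exp (h - A) \<le> exp (A - 3 * h)" using A by simp
    moreover have "exp (A - h) * exp (- 2 * h) = exp (A - 3 * h)" by (simp flip: exp_add)
    ultimately show ?thesis by (simp add: sinh_def algebra_simps)
  qed
  then have "exp (A - h) * (1 - exp (- 2 * h)) * sinh h \<le> 2 * sinh (A - h) * sinh h"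
    using h0 by (intro mult_right_mono) auto
  also have "2 * sinh (A - h) * sinh h = cosh ((A - h) + h) - cosh ((A - h) - h)"
    unfolding cosh_add cosh_diff by simp
  also have "\<dots> = cosh A - cosh (A - 2 * h)" by (simp add: algebra_simps)
  also have "\<dots> \<le> cosh A - cosh (\<alpha> * b)"
    using A \<alpha> b by (simp add: cosh_real_nonneg_le_iff)
  finally have num: "exp (A - h) * (1 - exp (- 2 * h)) * sinh h \<le> cosh A - cosh (\<alpha> * b)" .
  have den: "cosh (\<alpha> * R) - 1 \<le> exp (\<alpha> * R) / 2"
  proof -
    define e where "e = exp (- (\<alpha> * R))"
    have "e \<le> 1" using \<alpha> R by (simp add: e_def)
    moreover have "cosh (\<alpha> * R) = (exp (\<alpha> * R) + e) / 2" by (simp add: cosh_def e_def)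
    ultimately show ?thesis by (simp add: add_divide_distrib)
  qed
  have "2 * exp (- h) * (1 - exp (- 2 * h)) * sinh h * exp (\<alpha> * (a - R))
      = exp (A - h) * (1 - exp (- 2 * h)) * sinh h / (exp (\<alpha> * R) / 2)"
    by (simp add: A_def exp_diff exp_minus field_simps right_diff_distrib)
  also have "\<dots> \<le> (cosh A - cosh (\<alpha> * b)) / (cosh (\<alpha> * R) - 1)"
  proof (rule frac_le[OF _ num _ den])
    show "0 \<le> cosh A - cosh (\<alpha> * b)" using h0 by (intro order_trans[OF _ num]) auto
  qed (use c1 in simp)
  finally show ?thesis by (simp add: A_def)
qed

text \<open>The arc has the fraction \<open>2 ^ l / (D * 2 ^ T)\<close> of the circle, and the
  radial mass is at least a constant times \<open>2 powr (- 2 * \<alpha> * l)\<close>. The product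
  grows with \<open>l\<close> exactly when \<open>\<alpha> < 1 / 2\<close>.\<close>

lemma cell_prob_ge:
  assumes \<alpha>: "0 < \<alpha>" and R: "2 * real T * ln 2 + 2 * ln 2 \<le> R" and l: "l \<le> T"
    and w: "0 < w" "w * 2 ^ T * real D = 2 * pi" "j < D * 2 ^ (T - l)" and D: "0 < D"
    and h: "h = \<alpha> * ln 2"
  shows "2 * exp (- h) * (1 - exp (- 2 * h)) * sinh h * (2 powr ((1 - 2 * \<alpha>) * real l)) / (real D * 2 ^ T)
    \<le> measure (point_measure \<alpha> R) (cell R T w l j)"
proof -
  define \<kappa> where "\<kappa> = 2 * exp (- h) * (1 - exp (- 2 * h)) * sinh h"
  have RT: "2 * real T * ln 2 \<le> R" "0 < R"
  proof -
    have "0 < ln (2::real)" "0 \<le> 2 * real T * ln 2" by simp_all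
    then show "2 * real T * ln 2 \<le> R" "0 < R" using R by linarith+
  qed
  let ?a = "level_radius R T l" and ?b = "level_radius R T (Suc l)"
  have ab: "0 \<le> ?b" "?b \<le> ?a" "?a \<le> R" using level_radius_bounds[OF RT(1)] level_radius_mono[OF RT(1)] by auto
  \<comment> \<open>The cell of level \<open>T\<close> ends at the origin; the extra
    \<open>2 * ln 2\<close> in the bound on \<open>R\<close> makes it thick enough.\<close>
  have gap: "?b \<le> ?a - 2 * ln 2"
  proof (cases "l = T")
    case True
    then show ?thesis using R by (simp add: level_radius_def)
  next
    case False
    then show ?thesis using l by (simp add: level_radius_def algebra_simps)
  qed
  have arc_le: "w * 2 ^ l * (real j + 1) \<le> 2 * pi"
  proof -
    have "real j + 1 \<le> real D * 2 ^ (T - l)"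
    proof -
      have "real (j + 1) \<le> real (D * 2 ^ (T - l))" using w(3) by (subst of_nat_le_iff) simp
      then show ?thesis by simp
    qed
    then have "w * 2 ^ l * (real j + 1) \<le> w * 2 ^ l * (real D * 2 ^ (T - l))" using w by (intro mult_left_mono) auto
    also have "\<dots> = w * (2 ^ l * 2 ^ (T - l)) * real D" by (simp add: algebra_simps)
    also have "2 ^ l * 2 ^ (T - l) = (2 ^ T :: real)" using l by (simp flip: power_add)
    finally show ?thesis using w by simp
  qed
  have wid: "(w * 2 ^ l * (real j + 1) - w * 2 ^ l * real j) / (2 * pi) = 2 ^ l / (real D * 2 ^ T)"
    unfolding w(2)[symmetric] using w(1) D by (simp add: field_simps)
  have "\<kappa> * 2 powr ((1 - 2 * \<alpha>) * real l) / (real D * 2 ^ T) = \<kappa> * exp (\<alpha> * (?a - R)) * (2 ^ l / (real D * 2 ^ T))"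
  proof -
    have "2 powr ((1 - 2 * \<alpha>) * real l) = exp (\<alpha> * (?a - R)) * 2 ^ l"
      using l by (simp add: powr_def level_radius_def exp_of_nat_mult[symmetric] exp_add[symmetric] powr_realpow[symmetric] algebra_simps)
    then show ?thesis by simp
  qed
  also have "\<dots> \<le> (cosh (\<alpha> * ?a) - cosh (\<alpha> * ?b)) / (cosh (\<alpha> * R) - 1) * (2 ^ l / (real D * 2 ^ T))"
    using radial_mass_ge[OF \<alpha> h RT(2) ab(1) gap ab(3)] unfolding \<kappa>_def by (intro mult_right_mono) auto
  also have "\<dots> = measure (point_measure \<alpha> R) (cell R T w l j)"
    unfolding cell_def level_arc_def using \<alpha> RT ab arc_le w
    by (subst measure_point_measure_Ioc) (auto simp: wid intro!: mult_left_mono)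
  finally show ?thesis by (simp add: \<kappa>_def)
qed

lemma cell_borel: "cell R T w l j \<in> sets borel"
  unfolding cell_def level_arc_def by (simp add: borel_prod[symmetric])

text \<open>The parameters \<open>T\<close>, \<open>D\<close> and \<open>w\<close> are fitted to
  \<open>n\<close> so that the cells are narrow enough for adjacency and yet heavy enough for the
  weights. A union bound over the \<open>D\<close> top sectors finishes the proof.\<close>

lemma hamilton_cycle_aas:
  assumes \<alpha>: "0 < \<alpha>" "\<alpha> < 1 / 2" and h: "h = \<alpha> * ln 2"
    and \<kappa>: "\<kappa> = 2 * exp (- h) * (1 - exp (- 2 * h)) * sinh h" and \<nu>: "78 / \<kappa> < \<nu>"
  shows "kpkvb_aas \<alpha> \<nu> has_hamilton_cycle"
proof -
  have \<kappa>0: "0 < \<kappa>" using \<alpha> by (simp add: \<kappa> h)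
  then have \<nu>0: "0 < \<nu>" using \<nu> by (auto intro: less_trans[of 0 "78 / \<kappa>"])
  have \<kappa>\<nu>: "78 \<le> \<kappa> * \<nu>" using \<nu> \<kappa>0 by (simp add: field_simps)
  define \<beta> where "\<beta> = 1 - 2 * \<alpha>"
  have \<beta>: "0 < \<beta>" using \<alpha> by (simp add: \<beta>_def)
  \<comment> \<open>For positive \<open>n\<close> this is \<open>exp (R / 4)\<close>.\<close>
  define X where "X n = sqrt (real n / \<nu>)" for n :: nat
  have Xlim: "filterlim X at_top sequentially"
  proof -
    have "filterlim (\<lambda>n. real n * (1 / \<nu>)) at_top sequentially"
      using \<nu>0 by (intro filterlim_at_top_mult_tendsto_pos[OF tendsto_const] filterlim_real_sequentially) auto
    then show ?thesis unfolding X_def[abs_def] by (intro filterlim_compose[OF sqrt_at_top]) simp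
  qed
  show ?thesis
  proof (rule kpkvb_aasI[OF \<alpha>(1) \<nu>0 has_hamilton_cycle_cong])
    have "((\<lambda>x. 52 * exp 4 * (x * exp (- 3 * x powr \<beta>))) \<longlongrightarrow> 0) at_top"
      using \<beta> by real_asymp
    from filterlim_compose[OF this Xlim]
    show "(\<lambda>n. 52 * exp 4 * (X n * exp (- 3 * X n powr \<beta>))) \<longlonglongrightarrow> 0" .
    have "eventually (\<lambda>n. 4 \<le> X n) sequentially" using Xlim by (simp add: filterlim_at_top)
    moreover have "eventually (\<lambda>n. 3 \<le> n) sequentially" by (rule eventually_ge_at_top)
    ultimately show "eventually (\<lambda>n. \<exists>A\<in>sets (kpkvb_space n \<alpha> \<nu>).
        measure (kpkvb_space n \<alpha> \<nu>) A \<le> 52 * exp 4 * (X n * exp (- 3 * X n powr \<beta>)) \<and>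
        (\<forall>x. (\<forall>i<n. x i \<in> disk_R (kpkvb_R \<nu> n)) \<longrightarrow> x \<in> space (kpkvb_space n \<alpha> \<nu>) \<longrightarrow> x \<notin> A \<longrightarrow>
          has_hamilton_cycle n (kpkvb_adj (kpkvb_R \<nu> n) x))) sequentially"
    proof eventually_elim
      case (elim n)
      define R where "R = kpkvb_R \<nu> n"
      define Y where "Y = X n"
      have Y: "4 \<le> Y" using elim by (simp add: Y_def)
      have nY: "real n = \<nu> * Y\<^sup>2" using \<nu>0 by (simp add: Y_def X_def)
      have RY: "R = 4 * ln Y"
        using \<nu>0 Y nY ln_realpow[of Y 2] by (simp add: R_def kpkvb_R_def)
      \<comment> \<open>Hence \<open>Y \<le> 2 ^ T < 2 * Y\<close>: the top radius
        \<open>R - 2 * T * ln 2\<close> is at most \<open>R / 2\<close>, by less than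
        \<open>2 * ln 2\<close>.\<close>
      define T where "T = (LEAST m. Y \<le> 2 ^ m)"
      have "\<exists>m. Y < 2 ^ m" by (rule real_arch_pow) simp
      then have T1: "Y \<le> 2 ^ T" unfolding T_def by (metis LeastI less_imp_le)
      then have "T \<noteq> 0" using Y by (intro notI) simp
      then obtain t where t: "T = Suc t" by (cases T) auto
      have "\<not> Y \<le> 2 ^ t" using not_less_Least[of t "\<lambda>m. Y \<le> 2 ^ m"] t by (simp add: T_def)
      then have T2: "2 ^ T < 2 * Y" by (simp add: t)
      \<comment> \<open>Rounding up makes \<open>D\<close> sectors of equal width fill the circle,
        with \<open>D * 2 ^ T\<close> between \<open>12 * Y\<^sup>2\<close> and
        \<open>13 * Y\<^sup>2\<close>.\<close>
      define D where "D = nat \<lceil>12 * Y\<^sup>2 / 2 ^ T\<rceil>"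
      have pos: "0 < 12 * Y\<^sup>2 / 2 ^ T" using Y by simp
      have D1: "12 * Y\<^sup>2 / 2 ^ T \<le> real D" unfolding D_def by (rule real_nat_ceiling_ge)
      then have D0: "0 < D" using pos by (cases "D = 0") auto
      have D2: "real D \<le> 12 * Y\<^sup>2 / 2 ^ T + 1"
        using pos of_int_ceiling_le_add_one[of "12 * Y\<^sup>2 / 2 ^ T"] unfolding D_def by (subst of_nat_nat) auto
      \<comment> \<open>This absorbs the rounding error \<open>2 ^ T < 2 * Y\<close> in
        \<open>DT\<close> and leaves the extra thickness \<open>2 * ln 2\<close> in
        \<open>R1\<close>.\<close>
      have YY: "4 * Y \<le> Y\<^sup>2" using Y by (simp add: power2_eq_square)
      have DT: "real D * 2 ^ T \<le> 13 * Y\<^sup>2"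
      proof -
        have "real D * 2 ^ T \<le> (12 * Y\<^sup>2 / 2 ^ T + 1) * 2 ^ T" using D2 by (intro mult_right_mono) auto
        also have "\<dots> = 12 * Y\<^sup>2 + 2 ^ T" by (simp add: field_simps)
        finally show ?thesis using T2 YY Y by linarith
      qed
      have DY: "real D \<le> 13 * Y"
      proof -
        have "12 * Y\<^sup>2 / 2 ^ T \<le> 12 * Y\<^sup>2 / Y" using T1 Y by (intro divide_left_mono) auto
        also have "\<dots> = 12 * Y" using Y by (simp add: power2_eq_square)
        finally show ?thesis using D2 Y by linarith
      qed
      define w where "w = 2 * pi / (real D * 2 ^ T)"
      have w: "0 < w" "w * 2 ^ T * real D = 2 * pi" using D0 by (auto simp: w_def)
      have w2: "w\<^sup>2 \<le> exp (- R) / 2"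
      proof -
        have "12 * Y\<^sup>2 \<le> real D * 2 ^ T" using D1 by (simp add: field_simps)
        \<comment> \<open>The factor 12 is chosen for this: with \<open>pi < 4\<close>,
          \<open>w\<close> is at most \<open>(2 / 3) / Y\<^sup>2\<close>, and
          \<open>4 / 9 \<le> 1 / 2\<close>.\<close>
        then have "w \<le> 2 * 4 / (12 * Y\<^sup>2)"
          unfolding w_def using pi_less_4 Y by (intro frac_le) auto
        then have "w\<^sup>2 \<le> (2 * 4 / (12 * Y\<^sup>2))\<^sup>2" using w(1) by (intro power_mono) auto
        also have "\<dots> \<le> 1 / (2 * Y ^ 4)" using Y by (simp add: power_divide power_mult_distrib field_simps)
        also have "\<dots> = exp (- R) / 2"
        proof -
          have "exp R = Y ^ 4" using Y exp_of_nat_mult[of 4 "ln Y"] by (simp add: RY)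
          then show ?thesis by (simp add: exp_minus inverse_eq_divide)
        qed
        finally show ?thesis .
      qed
      have lnT: "real T * ln 2 = ln (2 ^ T)" by (simp add: ln_realpow)
      have R1: "2 * real T * ln 2 + 2 * ln 2 \<le> R"
      proof -
        have "ln (2 ^ T * 2) \<le> ln (Y\<^sup>2)" using T2 YY Y by (subst ln_le_cancel_iff) auto
        then have "ln (2 ^ T) + ln 2 \<le> 2 * ln Y" using Y by (simp add: ln_mult ln_realpow)
        then show ?thesis using lnT by (simp add: RY)
      qed
      have R2: "R \<le> 4 * real T * ln 2"
      proof -
        have "ln Y \<le> ln (2 ^ T)" using T1 Y by (subst ln_le_cancel_iff) auto
        then show ?thesis using lnT by (simp add: RY)
      qed
      have R1': "2 * real T * ln 2 \<le> R" "0 < R"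
      proof -
        have "0 < ln (2::real)" "0 \<le> 2 * real T * ln 2" by simp_all
        then show "2 * real T * ln 2 \<le> R" "0 < R" using R1 by linarith+
      qed
      interpret M: prob_space "point_measure \<alpha> R" using \<alpha>(1) R1'(2) by (rule prob_space_point_measure)
      let ?P = "PiM {0..<n} (\<lambda>_. point_measure \<alpha> R)"
      interpret P: prob_space ?P by (intro prob_space_PiM M.prob_space_axioms)
      \<comment> \<open>The threshold on \<open>\<nu>\<close> comes from \<open>78 = 6 * 13\<close>:
        six expected hits, and 13 from \<open>DT\<close>.\<close>
      have cell_prob: "6 * 2 powr (\<beta> * real l) \<le> real n * M.prob (cell R T w l j)" if "l \<le> T" "j < D * 2 ^ (T - l)" for l j
      proof -
        have "6 * 2 powr (\<beta> * real l) \<le> (\<kappa> * \<nu> / 13) * 2 powr (\<beta> * real l)"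
          using \<kappa>\<nu> by (intro mult_right_mono) auto
        also have "\<dots> = \<kappa> * 2 powr (\<beta> * real l) * (\<nu> * Y\<^sup>2 / (13 * Y\<^sup>2))" using Y by simp
        also have "\<dots> \<le> \<kappa> * 2 powr (\<beta> * real l) * (\<nu> * Y\<^sup>2 / (real D * 2 ^ T))"
          using DT D0 \<kappa>0 \<nu>0 Y by (intro mult_left_mono divide_left_mono) auto
        also have "\<dots> = real n * (\<kappa> * 2 powr (\<beta> * real l) / (real D * 2 ^ T))" by (simp add: nY)
        also have "\<dots> \<le> real n * M.prob (cell R T w l j)"
          unfolding \<kappa> \<beta>_def
          by (intro mult_left_mono cell_prob_ge[OF \<alpha>(1) R1 that(1) w that(2) D0 h]) auto
        finally show ?thesis .
      qed
      have large: "6 \<le> real n * M.prob (cell R T w l j)" if "0 < l" "l \<le> t" "j < 2 * D * 2 ^ (t - l)" for l j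
      proof -
        have "j < D * 2 ^ (T - l)" using that by (simp add: t Suc_diff_le mult.assoc mult.left_commute)
        from cell_prob[OF _ this] have "6 * 2 powr (\<beta> * real l) \<le> real n * M.prob (cell R T w l j)"
          using that t by simp
        moreover have "1 \<le> 2 powr (\<beta> * real l)" using \<beta> by (simp add: ge_one_powr_ge_zero)
        ultimately show ?thesis by linarith
      qed
      define W where "W j x = tree_weight n (cell R T w) t (2 * j) x * tree_weight n (cell R T w) t (2 * j + 1) x
         * exp (- real (hits n (cell R T w (Suc t) j) x))" for j x
      have cellM: "cell R T w l j \<in> M.events" for l j by (simp add: cell_borel)
      have sub: "sector R T w l (2 * j) \<union> sector R T w l (2 * j + 1) \<union> cell R T w (Suc l) j \<subseteq> sector R T w (Suc l) j" for l j
        using sector_Suc[OF R1'(1) w(1)] by blast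
      have disj: "sector R T w l (2 * j) \<inter> sector R T w l (2 * j + 1) = {}"
        "sector R T w l j \<inter> cell R T w (Suc l) (j div 2) = {}" for l j
        using sector_disjoint[OF w(1), of "2 * j" "2 * j + 1"] sector_cell_disjoint by auto
      have W_meas: "W j \<in> borel_measurable ?P"
        and W_le: "P.prob {x \<in> space ?P. exp (- 2) \<le> W j x} \<le> 4 * exp 4 * exp (- real n * M.prob (cell R T w (Suc t) j) / 2)"
        if "j < D" for j
        unfolding W_def[abs_def]
        by (rule M.tree_weight_top_prob[where B = "cell R T w" and U = "sector R T w" and D = D, OF cellM sub disj _ that],
            erule (2) large)+
      define A where "A = (\<Union>j\<in>{0..<D}. {x \<in> space ?P. exp (- 2) \<le> W j x})"
      have W_sets: "{x \<in> space ?P. exp (- 2) \<le> W j x} \<in> sets ?P" if "j < D" for j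
        using W_meas[OF that] by measurable
      have W_prob: "P.prob {x \<in> space ?P. exp (- 2) \<le> W j x} \<le> 4 * exp 4 * exp (- 3 * Y powr \<beta>)" if "j < D" for j
      proof -
        \<comment> \<open>At the top level the expected number of hits is at least
          \<open>6 * Y powr \<beta>\<close>, a positive power of \<open>n\<close> up to a constant,
          which beats the number of sectors.\<close>
        have "Y powr \<beta> \<le> (2 ^ T) powr \<beta>" using T1 Y \<beta> by (intro powr_mono2) auto
        also have "\<dots> = 2 powr (\<beta> * real T)" by (simp add: powr_powr mult.commute flip: powr_realpow)
        finally have "6 * Y powr \<beta> \<le> real n * M.prob (cell R T w T j)"
          using cell_prob[of T j] that by simp
        then have "exp (- real n * M.prob (cell R T w (Suc t) j) / 2) \<le> exp (- 3 * Y powr \<beta>)" by (simp add: t)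
        then have "4 * exp 4 * exp (- real n * M.prob (cell R T w (Suc t) j) / 2) \<le> 4 * exp 4 * exp (- 3 * Y powr \<beta>)"
          by simp
        then show ?thesis using W_le[OF that] by linarith
      qed
      have "A \<in> sets ?P" unfolding A_def using W_sets by (intro sets.finite_UN) auto
      moreover have "P.prob A \<le> 52 * exp 4 * (Y * exp (- 3 * Y powr \<beta>))"
      proof -
        \<comment> \<open>Union bound over at most \<open>13 * Y\<close> sectors;
          \<open>52 = 13 * 4\<close>.\<close>
        have "P.prob A \<le> (\<Sum>j\<in>{0..<D}. P.prob {x \<in> space ?P. exp (- 2) \<le> W j x})"
          unfolding A_def using W_sets by (intro measure_UNION_le) auto
        also have "\<dots> \<le> (\<Sum>j\<in>{0..<D}. 4 * exp 4 * exp (- 3 * Y powr \<beta>))"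
          using W_prob by (intro sum_mono) auto
        also have "\<dots> = real D * (4 * exp 4 * exp (- 3 * Y powr \<beta>))" by simp
        also have "\<dots> \<le> 13 * Y * (4 * exp 4 * exp (- 3 * Y powr \<beta>))" using DY by (intro mult_right_mono) auto
        finally show ?thesis by (simp add: mult_ac)
      qed
      moreover have "has_hamilton_cycle n (kpkvb_adj R x)"
        if disk: "\<And>i. i < n \<Longrightarrow> x i \<in> disk_R R" and x: "x \<in> space ?P" "x \<notin> A" for x
      proof (rule has_hamilton_cycle_if_tree_weights_small[where t = t and w = w and D = D and R = R and x = x])
        show "tree_weight n (cell R (Suc t) w) t (2 * j) x * tree_weight n (cell R (Suc t) w) t (2 * j + 1) x
          * exp (- real (hits n (cell R (Suc t) w (Suc t) j) x)) < exp (- 2)" if "j < D" for j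
          using x that by (auto simp: A_def W_def t not_le)
        show "symp (kpkvb_adj R x)" by (rule kpkvb_adj_symp)
      qed (use R1' R2 w w2 D0 elim disk in \<open>auto simp: t kpkvb_adj_def\<close>)
      ultimately show ?case
        unfolding kpkvb_space_def R_def[symmetric] Y_def[symmetric] by (intro bexI[of _ A]) auto
    qed
  qed
qed

theorem theorem1:
  fixes \<alpha> :: real
  assumes "0 < \<alpha>" and "\<alpha> < 1/2"
  shows "\<exists>\<nu>0 \<nu>1 :: real. 0 < \<nu>0 \<and>
    (\<forall>\<nu>. 0 < \<nu> \<and> \<nu> < \<nu>0 \<longrightarrow>
        kpkvb_aas \<alpha> \<nu> (\<lambda>n E. \<not> has_near_perfect_matching n E) \<and>
        kpkvb_aas \<alpha> \<nu> (\<lambda>n E. \<not> has_hamilton_cycle n E)) \<and>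
    (\<forall>\<nu>. 0 < \<nu> \<and> \<nu>1 < \<nu> \<longrightarrow> kpkvb_aas \<alpha> \<nu> has_hamilton_cycle)"
proof -
  \<comment> \<open>The thresholds are explicit: \<open>\<nu>0 = exp (- C) / 256\<close> and
    \<open>\<nu>1 = 78 / \<kappa>\<close>.\<close>
  define C where "C = ln 16 / \<alpha>"
  define h where "h = \<alpha> * ln 2"
  define \<kappa> where "\<kappa> = 2 * exp (- h) * (1 - exp (- 2 * h)) * sinh h"
  have npm: "kpkvb_aas \<alpha> \<nu> (\<lambda>n E. \<not> has_near_perfect_matching n E)"
    if "0 < \<nu>" "\<nu> < exp (- C) / 256" for \<nu>
    using that by (intro no_near_perfect_matching_aas[OF assms(1) _ C_def]) (auto simp: exp_minus field_simps)
  moreover have "kpkvb_aas \<alpha> \<nu> (\<lambda>n E. \<not> has_hamilton_cycle n E)"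
    if "0 < \<nu>" "\<nu> < exp (- C) / 256" for \<nu>
  proof (rule kpkvb_aas_mono[OF assms(1) that(1) npm[OF that]])
    show "\<not> has_near_perfect_matching n E \<Longrightarrow> \<not> has_hamilton_cycle n E" for n E
      using near_perfect_matching_if_hamilton_cycle by blast
    show "(\<not> has_near_perfect_matching n E) = (\<not> has_near_perfect_matching n E')"
      if "\<And>i j. i < n \<Longrightarrow> j < n \<Longrightarrow> E i j = E' i j" for n E E'
      using has_near_perfect_matching_cong[OF that] by simp
    show "(\<not> has_hamilton_cycle n E) = (\<not> has_hamilton_cycle n E')"
      if "\<And>i j. i < n \<Longrightarrow> j < n \<Longrightarrow> E i j = E' i j" for n E E'
      using has_hamilton_cycle_cong[OF that] by simp
  qed
  moreover have "kpkvb_aas \<alpha> \<nu> has_hamilton_cycle" if "78 / \<kappa> < \<nu>" for \<nu>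
    using assms h_def \<kappa>_def that by (rule hamilton_cycle_aas)
  ultimately show ?thesis by (intro exI[of _ "exp (- C) / 256"] exI[of _ "78 / \<kappa>"]) auto
qed

end
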